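(* Let $n\ge p\ge 2$, let $\mathbf{X}\in\mathbb{R}^{n\times p}$ be a Gaussian random matrix with mean $\mathbf{M}$ and mutually independent rows with positive definite covariance matrix $\boldsymbol{\Sigma}\in\mathbb{R}^{p\times p}$, and assume $\tilde{\mathbf{m}}_1\neq\mathbf{0}$. Let $\rho=w_{11\cdot 2}/\sigma_{11\cdot 2}$ be the scaled scalar Schur complement in $\mathbf{W}=\mathbf{X}'\mathbf{X}$, and let $u$, $\lambda$, $\nu=n-p+1$ be as defined in the context. Then, conditionally on $u$, $\rho$ has the noncentral chi-square distribution with $\nu$ degrees of freedom and noncentrality parameter $\lambda u$. Consequently, with $h$ denoting the p.d.f. of $u$ on $[0,1]$, the distribution of $\rho$ is a mixture of noncentral chi-square distributions and also a mixture of central chi-square distributions with different degrees of freedom: the p.d.f. of $\rho$ is $$p_\rho(w)=\int_0^1 g(w;\nu,\lambda u)\,h(u)\,du=\sum_{k=0}^\infty \beta_k\,g_{\nu+2k}(w),\qquad w>0,$$ where $$\beta_k=\frac{(\lambda/2)^k}{k!}\int_0^1 u^k e^{-\lambda u/2}h(u)\,du,\qquad k=0,1,2,\ldots,$$ and the weights satisfy $\beta_k\ge 0$ and $\sum_{k=0}^\infty\beta_k=1$.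
   Context: Partition into first column and remaining columns: $\mathbf{X}=(\mathbf{x}_1\ \mathbf{X}_2)$, $\mathbf{M}=(\mathbf{m}_1\ \mathbf{M}_2)$, with $\mathbf{x}_1,\mathbf{m}_1\in\mathbb{R}^n$ and $\mathbf{X}_2,\mathbf{M}_2\in\mathbb{R}^{n\times(p-1)}$, and $$\boldsymbol{\Sigma}=\begin{pmatrix}\sigma_{11}&\boldsymbol{\sigma}_{21}'\\ \boldsymbol{\sigma}_{21}&\boldsymbol{\Sigma}_{22}\end{pmatrix},\qquad \sigma_{11\cdot 2}=\sigma_{11}-\boldsymbol{\sigma}_{21}'\boldsymbol{\Sigma}_{22}^{-1}\boldsymbol{\sigma}_{21}.$$ A prime denotes transpose. With $\mathbf{W}=\mathbf{X}'\mathbf{X}=\begin{pmatrix}w_{11}&\mathbf{w}_{21}'\\ \mathbf{w}_{21}&\mathbf{W}_{22}\end{pmatrix}$ partitioned analogously, the scalar Schur complement of $\mathbf{W}_{22}$ in $\mathbf{W}$ is $$w_{11\cdot 2}=w_{11}-\mathbf{w}_{21}'\mathbf{W}_{22}^{-1}\mathbf{w}_{21}=\mathbf{x}_1'\mathbf{Q}_2\mathbf{x}_1,\qquad \mathbf{Q}_2=\mathbf{I}_n-\mathbf{X}_2(\mathbf{X}_2'\mathbf{X}_2)^{-1}\mathbf{X}_2'.$$ Define $$\tilde{\mathbf{m}}_1=\mathbf{m}_1-\mathbf{M}_2\boldsymbol{\Sigma}_{22}^{-1}\boldsymbol{\sigma}_{21},\quad u=\frac{\tilde{\mathbf{m}}_1'\mathbf{Q}_2\tilde{\mathbf{m}}_1}{\|\tilde{\mathbf{m}}_1\|^2}\in[0,1],\quad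 \lambda=\frac{\|\tilde{\mathbf{m}}_1\|^2}{\sigma_{11\cdot 2}},\quad \nu=n-p+1.$$ The central chi-square p.d.f. with $m$ degrees of freedom is $g_m(w)=\frac{1}{2^{m/2}\Gamma(m/2)}w^{m/2-1}e^{-w/2}$, $w>0$, and the noncentral chi-square p.d.f. with $\nu$ degrees of freedom and noncentrality parameter $\delta$ is $g(w;\nu,\delta)=\sum_{k=0}^\infty\frac{(\delta/2)^k}{k!}e^{-\delta/2}g_{\nu+2k}(w)$, $w>0$. *)

theory Defs
  imports "HOL-Probability.Probability"
begin

text \<open>
  The p columns are indexed by \<open>'q option\<close>: \<open>None\<close> is the first column and \<open>Some j\<close> ranges over
  the remaining p - 1 columns.  Since \<open>'q\<close> is an arbitrary finite (nonempty) type, this covers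
  exactly all p \<open>\<ge>\<close> 2.
\<close>

definition first_col :: "real ^ ('q::finite option) ^ 'n \<Rightarrow> real ^ 'n::finite" where
  "first_col A = (\<chi> i. A $ i $ None)"

definition rest_cols :: "real ^ ('q::finite option) ^ 'n \<Rightarrow> real ^ 'q ^ 'n::finite" where
  "rest_cols A = (\<chi> i j. A $ i $ Some j)"

definition blk11 :: "real ^ ('q::finite option) ^ ('q option) \<Rightarrow> real" where
  "blk11 S = S $ None $ None"

definition blk21 :: "real ^ ('q::finite option) ^ ('q option) \<Rightarrow> real ^ 'q" where
  "blk21 S = (\<chi> i. S $ Some i $ None)"

definition blk22 :: "real ^ ('q::finite option) ^ ('q option) \<Rightarrow> real ^ 'q ^ 'q" where
  "blk22 S = (\<chi> i j. S $ Some i $ Some j)"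

definition schur11 :: "real ^ ('q::finite option) ^ ('q option) \<Rightarrow> real" where
  "schur11 S = blk11 S - blk21 S \<bullet> (matrix_inv (blk22 S) *v blk21 S)"

definition pos_def_matrix :: "real ^ 'k ^ 'k::finite \<Rightarrow> bool" where
  "pos_def_matrix S \<longleftrightarrow> transpose S = S \<and> (\<forall>x. x \<noteq> 0 \<longrightarrow> x \<bullet> (S *v x) > 0)"

definition mvn_density :: "real ^ 'k \<Rightarrow> real ^ 'k ^ 'k::finite \<Rightarrow> real ^ 'k \<Rightarrow> real" where
  "mvn_density \<mu> S x =
     exp (- ((x - \<mu>) \<bullet> (matrix_inv S *v (x - \<mu>))) / 2) / sqrt ((2 * pi) ^ CARD('k) * det S)"

definition gaussian_matrix ::
  "'a measure \<Rightarrow> ('a \<Rightarrow> real ^ 'k ^ 'n) \<Rightarrow> real ^ 'k ^ 'n::finite \<Rightarrow> real ^ 'k ^ 'k::finite \<Rightarrow> bool" where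
  "gaussian_matrix P X M S \<longleftrightarrow>
     prob_space.indep_vars P (\<lambda>_. borel) (\<lambda>i \<omega>. X \<omega> $ i) UNIV \<and>
     (\<forall>i. distributed P lborel (\<lambda>\<omega>. X \<omega> $ i) (\<lambda>x. ennreal (mvn_density (M $ i) S x)))"

definition resid_proj :: "real ^ 'q ^ 'n \<Rightarrow> real ^ 'n ^ 'n::finite" where
  "resid_proj X2 = mat 1 - X2 ** matrix_inv (transpose X2 ** X2) ** transpose X2"

definition m_tilde ::
  "real ^ ('q::finite option) ^ 'n \<Rightarrow> real ^ ('q option) ^ ('q option) \<Rightarrow> real ^ 'n::finite" where
  "m_tilde M S = first_col M - rest_cols M *v (matrix_inv (blk22 S) *v blk21 S)"

definition chisq_density :: "nat \<Rightarrow> real \<Rightarrow> real" where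
  "chisq_density m w =
     (if w > 0 then w powr (real m / 2 - 1) * exp (- w / 2) / (2 powr (real m / 2) * Gamma (real m / 2))
      else 0)"

definition ncchisq_density :: "nat \<Rightarrow> real \<Rightarrow> real \<Rightarrow> real" where
  "ncchisq_density \<nu> \<delta> w =
     (\<Sum>k. (\<delta> / 2) ^ k / fact k * exp (- \<delta> / 2) * chisq_density (\<nu> + 2 * k) w)"

definition ncchisq_distr :: "nat \<Rightarrow> real \<Rightarrow> real measure" where
  "ncchisq_distr \<nu> \<delta> = density lborel (\<lambda>w. ennreal (ncchisq_density \<nu> \<delta> w))"

text \<open>\<open>f\<close> is a p.d.f. of \<open>X\<close> on \<open>S\<close>: the values of \<open>f\<close> outside \<open>S\<close> are irrelevant.\<close>

definition is_pdf_on :: "'a measure \<Rightarrow> ('a \<Rightarrow> real) \<Rightarrow> real set \<Rightarrow> (real \<Rightarrow> real) \<Rightarrow> bool" where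
  "is_pdf_on P X S f \<longleftrightarrow>
     (\<forall>x\<in>S. 0 \<le> f x) \<and> distributed P lborel X (\<lambda>x. ennreal (f x * indicator S x))"

text \<open>
  Conditionally on \<open>Y\<close>, the variable \<open>X\<close> has distribution \<open>K Y\<close>: the family \<open>K\<close> is a
  regular version of the conditional probabilities of \<open>X\<close> given the sigma-algebra generated by \<open>Y\<close>.
\<close>

definition cond_distributed ::
  "'a measure \<Rightarrow> ('a \<Rightarrow> real) \<Rightarrow> ('a \<Rightarrow> real) \<Rightarrow> (real \<Rightarrow> real measure) \<Rightarrow> bool" where
  "cond_distributed P X Y K \<longleftrightarrow>
     X \<in> borel_measurable P \<and> Y \<in> borel_measurable P \<and>
     (\<forall>A \<in> sets borel.
        (\<lambda>y. measure (K y) A) \<in> borel_measurable borel \<and>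
        (AE \<omega> in P. real_cond_exp P (vimage_algebra (space P) Y borel)
                       (\<lambda>\<omega>. indicator A (X \<omega>)) \<omega> = measure (K (Y \<omega>)) A))"

definition mix_weight :: "real \<Rightarrow> (real \<Rightarrow> real) \<Rightarrow> nat \<Rightarrow> real" where
  "mix_weight lam h k =
     (lam / 2) ^ k / fact k * (LBINT t:{0..1}. t ^ k * exp (- lam * t / 2) * h t)"

end

theory Submission
  imports Defs
begin

text \<open>
  Write the Schur complement of the Gram matrix of \<open>X = (x1 X2)\<close> as the squared length of \<open>Q2 x1\<close>, where \<open>Q2\<close>
  projects onto the orthogonal complement of the columns of \<open>X2\<close> (\<open>schur11_gram\<close>). Since \<open>Q2\<close> annihilates
  these columns, \<open>x1\<close> may be replaced by \<open>x1 - X2 b\<close> with \<open>b\<close> the vector of regression coefficients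
  (\<open>resid_shift\<close>). Completing the square in the joint density (\<open>quadratic_form_split\<close>) shows that
  \<open>y = (x1 - X2 b) / s\<close>, with \<open>s\<^sup>2\<close> the Schur complement of \<open>\<Sigma>\<close>, is a standard Gaussian vector shifted by
  \<open>m_tilde / s\<close> and independent of \<open>X2\<close> (\<open>nn_integral_gaussian_matrix\<close>). Thus \<open>\<rho>\<close> is the squared length of
  \<open>Q2 y\<close>, and for fixed \<open>X2\<close> a rotation identifies this with a sum of \<open>\<nu>\<close> squares of independent normal
  variables (\<open>gauss_law_resid_quadratic\<close>). Such a sum is noncentral chi-square with the squared length of the
  projected mean as noncentrality (\<open>sum_squares_normal_ncchisq\<close>), which is \<open>lam * u\<close>. The conditional law given
  \<open>X2\<close> depends on \<open>X2\<close> through \<open>u\<close> alone, so it is also the conditional law given \<open>u\<close>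
  (\<open>nn_integral_joint\<close>, \<open>cond_distributed_\<rho>\<close>).
  
  For the mixture representations one needs that the columns of \<open>X2\<close> are almost surely independent and that
  \<open>u\<close> has a density. Both are statements about Lebesgue null sets of matrices, and both are proved by looking at
  lines in one fixed direction (\<open>AE_lborel_along_lines\<close>): along a suitable line the Gram determinant is a
  nonzero polynomial up to rescaling (\<open>AE_inj_drop_dir\<close>), and along a rank one line in the direction of
  \<open>m_tilde\<close> the variable \<open>u\<close> is the reciprocal of a positive quadratic polynomial
  (\<open>resid_quadratic_reciprocal\<close>), which pulls null sets back to null sets
  (\<open>AE_resid_quadratic_notin_null\<close>). Integrating the conditional density against the density of \<open>u\<close>, and the
  Poisson series term by term (\<open>poisson_mixture_sums\<close>), gives the two mixtures (\<open>pdf_mixture\<close>).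
\<close>

section \<open>Central and noncentral chi-square densities\<close>

lemma chisq_density_nonneg [simp]: "0 \<le> chisq_density m w"
  by (cases "m = 0") (auto simp: chisq_density_def Gamma_real_nonneg)

lemma chisq_density_measurable [measurable]: "chisq_density m \<in> borel_measurable borel"
  unfolding chisq_density_def by measurable

lemma chisq_density_step:
  assumes "m > 0"
  shows "chisq_density (m + 2) w = chisq_density m w * w / m"
proof (cases "w > 0")
  case True
  have "Gamma (real m / 2 + 1) = real m / 2 * Gamma (real m / 2)"
    using assms by (intro Gamma_plus1) (auto elim!: nonpos_Ints_cases)
  moreover have "w powr (real m / 2) = w * w powr (real m / 2 - 1)"
    using True by (simp add: powr_diff)
  moreover have "(2::real) powr (real m / 2 + 1) = 2 * 2 powr (real m / 2)"
    by (simp add: powr_add)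
  moreover have "real (m + 2) / 2 = real m / 2 + 1" by (simp add: field_simps)
  ultimately show ?thesis using True assms
    unfolding chisq_density_def by (simp add: field_simps)
qed (simp add: chisq_density_def)

text \<open>
  The recursion in steps of two degrees of freedom makes the densities at a fixed point decay
  factorially in \<open>k\<close>; every series of chi-square densities below converges for this reason.
\<close>
lemma chisq_density_le:
  assumes "m > 0"
  shows "chisq_density (m + 2 * k) w \<le> chisq_density m w * \<bar>w\<bar> ^ k / fact k"
proof (cases "w > 0")
  case True
  show ?thesis
  proof (induction k)
    case (Suc k)
    have "chisq_density (m + 2 * Suc k) w = chisq_density (m + 2 * k) w * (w / (m + 2 * k))"
      using chisq_density_step[of "m + 2 * k" w] assms by (simp add: add.assoc)
    also have "\<dots> \<le> (chisq_density m w * \<bar>w\<bar> ^ k / fact k) * (\<bar>w\<bar> / Suc k)"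
      using True assms by (intro mult_mono Suc frac_le) auto
    finally show ?case by (simp add: field_simps)
  qed simp
qed (simp add: chisq_density_def)

lemma summable_chisq_mixture:
  assumes "m > 0"
  shows "summable (\<lambda>k. x ^ k / fact k * chisq_density (m + 2 * k) w)"
proof (rule summable_comparison_test)
  have "norm (x ^ k / fact k * chisq_density (m + 2 * k) w) \<le> chisq_density m w * (\<bar>x * w\<bar> ^ k /\<^sub>R fact k)" for k
  proof -
    have "norm (x ^ k / fact k * chisq_density (m + 2 * k) w) = \<bar>x\<bar> ^ k / fact k * chisq_density (m + 2 * k) w"
      by (simp add: abs_mult power_abs)
    also have "\<dots> \<le> \<bar>x\<bar> ^ k / 1 * (chisq_density m w * \<bar>w\<bar> ^ k / fact k)"
      using chisq_density_le[OF assms] by (intro mult_mono frac_le) auto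
    finally show ?thesis by (simp add: abs_mult power_mult_distrib field_simps)
  qed
  then show "\<exists>N. \<forall>n\<ge>N. norm (x ^ n / fact n * chisq_density (m + 2 * n) w) \<le> chisq_density m w * (\<bar>x * w\<bar> ^ n /\<^sub>R fact n)"
    by blast
qed (intro summable_mult summable_exp_generic)

text \<open>
  The Poisson distribution with mean \<open>\<delta> / 2\<close>: a noncentral chi-square distribution is a central one
  whose degrees of freedom are raised by twice a Poisson variable.
\<close>
definition pois :: "real \<Rightarrow> nat \<Rightarrow> real" where
  "pois \<delta> k = (\<delta> / 2) ^ k / fact k * exp (- \<delta> / 2)"

lemma pois_nonneg [simp]: "0 \<le> \<delta> \<Longrightarrow> 0 \<le> pois \<delta> k" by (simp add: pois_def)

lemma pois_convolution:
  "(\<Sum>k\<le>n. pois a k * pois b (n - k)) = pois (a + b) n"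
proof -
  have "((a + b) / 2) ^ n / fact n = (\<Sum>k\<le>n. ((a/2) ^ k / fact k) * ((b/2) ^ (n - k) / fact (n - k)))"
    unfolding add_divide_distrib binomial_ring sum_divide_distrib
    by (intro sum.cong) (auto simp: binomial_fact)
  then have "pois (a + b) n = (\<Sum>k\<le>n. ((a/2) ^ k / fact k) * ((b/2) ^ (n - k) / fact (n - k))) * (exp (- a / 2) * exp (- b / 2))"
    by (simp add: pois_def flip: exp_add add_divide_distrib)
  then show ?thesis by (simp add: pois_def sum_distrib_left sum_distrib_right mult_ac)
qed

lemma ncchisq_density_pois: "ncchisq_density m \<delta> w = (\<Sum>k. pois \<delta> k * chisq_density (m + 2 * k) w)"
  by (simp add: ncchisq_density_def pois_def)

lemma summable_ncchisq:
  assumes "m > 0"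
  shows "summable (\<lambda>k. pois \<delta> k * chisq_density (m + 2 * k) w)"
  using summable_mult2[OF summable_chisq_mixture[OF assms, of "\<delta> / 2" w], of "exp (- \<delta> / 2)"]
  by (simp add: pois_def mult_ac)

lemma ncchisq_nonneg: "0 \<le> \<delta> \<Longrightarrow> m > 0 \<Longrightarrow> 0 \<le> ncchisq_density m \<delta> w"
  unfolding ncchisq_density_pois by (intro suminf_nonneg summable_ncchisq) auto

lemma ncchisq_density_measurable [measurable]: "ncchisq_density m \<delta> \<in> borel_measurable borel"
  unfolding ncchisq_density_def by measurable

lemma ennreal_ncchisq:
  assumes "0 \<le> \<delta>" "m > 0"
  shows "ennreal (ncchisq_density m \<delta> w) = (\<Sum>k. ennreal (pois \<delta> k) * ennreal (chisq_density (m + 2 * k) w))"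
  using assms unfolding ncchisq_density_pois
  by (subst suminf_ennreal2[symmetric]) (auto simp: ennreal_mult summable_ncchisq)

text \<open>
  Substituting \<open>y = x * t\<close> turns the convolution into the Euler Beta integral, and the quotient of
  Gamma functions that results is the normalising constant for \<open>a + b\<close> degrees of freedom.
\<close>
lemma chisq_convolution:
  assumes "a > 0" "b > 0"
  shows "(\<integral>\<^sup>+y. ennreal (chisq_density a (x - y)) * ennreal (chisq_density b y) \<partial>lborel) = ennreal (chisq_density (a + b) x)"
proof (cases "x > 0")
  case False
  then have "chisq_density a (x - y) * chisq_density b y = 0" for y
    by (auto simp: chisq_density_def)
  then have "ennreal (chisq_density a (x - y)) * ennreal (chisq_density b y) = 0" for y
    by (metis chisq_density_nonneg ennreal_0 ennreal_mult)
  then have "(\<integral>\<^sup>+y. ennreal (chisq_density a (x - y)) * ennreal (chisq_density b y) \<partial>lborel) = 0"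
    by (simp only: nn_integral_const mult_zero_left)
  also have "0 = ennreal (chisq_density (a + b) x)"
    using False by (simp add: chisq_density_def)
  finally show ?thesis .
next
  case True
  define p q where "p = real a / 2" and "q = real b / 2"
  have pq: "p > 0" "q > 0" using assms by (auto simp: p_def q_def)
  define C where "C = x powr (p + q - 1) * exp (- x / 2) / (2 powr (p + q) * Gamma p * Gamma q)"
  have G: "Gamma p > 0" "Gamma q > 0" using pq by (auto simp: Gamma_real_pos)
  have C: "C \<ge> 0" unfolding C_def using G by (auto intro!: divide_nonneg_nonneg mult_nonneg_nonneg)
  have "(\<integral>\<^sup>+y. ennreal (chisq_density a (x - y)) * ennreal (chisq_density b y) \<partial>lborel)
      = (\<integral>\<^sup>+y. ennreal (chisq_density a (x - y) * chisq_density b y) \<partial>lborel)"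
    by (simp add: ennreal_mult)
  also have "\<dots> = ennreal x * (\<integral>\<^sup>+t. ennreal (chisq_density a (x - x * t) * chisq_density b (x * t)) \<partial>lborel)"
    using True by (subst nn_integral_real_affine[where c = x and t = 0]) auto
  also have "\<dots> = (\<integral>\<^sup>+t. ennreal (x * (chisq_density a (x - x * t) * chisq_density b (x * t))) \<partial>lborel)"
    using True by (subst nn_integral_cmult[symmetric]) (auto simp: ennreal_mult)
  also have "\<dots> = (\<integral>\<^sup>+t. ennreal C * ennreal (t powr (q - 1) * (1 - t) powr (p - 1)) * indicator {0..1} t \<partial>lborel)"
  proof (intro nn_integral_cong)
    fix t :: real
    show "ennreal (x * (chisq_density a (x - x * t) * chisq_density b (x * t))) =
      ennreal C * ennreal (t powr (q - 1) * (1 - t) powr (p - 1)) * indicator {0..1} t"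
    proof (cases "0 < t \<and> t < 1")
      case t: True
      have xt: "x - x * t = x * (1 - t)" by (simp add: algebra_simps)
      have "x * (chisq_density a (x - x * t) * chisq_density b (x * t)) =
        x * (((x * (1 - t)) powr (p - 1) * exp (- (x * (1 - t)) / 2) / (2 powr p * Gamma p)) *
         ((x * t) powr (q - 1) * exp (- (x * t) / 2) / (2 powr q * Gamma q)))"
        using t True unfolding xt chisq_density_def by (simp add: p_def q_def)
      also have "\<dots> = (x * (x powr (p - 1) * x powr (q - 1))) * (exp (- (x * (1 - t)) / 2) * exp (- (x * t) / 2)) /
          ((2 powr p * 2 powr q) * Gamma p * Gamma q) * (t powr (q - 1) * (1 - t) powr (p - 1))"
        using t True by (simp add: powr_mult mult_ac)
      also have "x * (x powr (p - 1) * x powr (q - 1)) = x powr (p + q - 1)"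
      proof -
        have "x powr (p + q - 1) = x powr (1 + ((p - 1) + (q - 1)))" by (simp add: algebra_simps)
        then show ?thesis using True by (simp only: powr_add) simp
      qed
      also have "exp (- (x * (1 - t)) / 2) * exp (- (x * t) / 2) = exp (- x / 2)"
        by (simp add: field_simps flip: exp_add)
      also have "2 powr p * 2 powr q = (2::real) powr (p + q)" by (simp add: powr_add)
      finally have "x * (chisq_density a (x - x * t) * chisq_density b (x * t)) = C * (t powr (q - 1) * (1 - t) powr (p - 1))"
        by (simp add: C_def)
      then show ?thesis using t C by (simp add: ennreal_mult)
    next
      case f: False
      then have "\<not> (x * t > 0 \<and> x - x * t > 0)" using True
        by (auto simp: zero_less_mult_iff)
      then have "chisq_density a (x - x * t) * chisq_density b (x * t) = 0"
        unfolding chisq_density_def by auto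
      moreover have "t = 0 \<or> t = 1 \<or> t \<notin> {0..1}" using f by auto
      ultimately show ?thesis by auto
    qed
  qed
  also have "\<dots> = ennreal C * (\<integral>\<^sup>+t. ennreal (indicator {0..1} t * (t powr (q - 1) * (1 - t) powr (p - 1))) \<partial>lborel)"
    by (subst nn_integral_cmult[symmetric]) (auto intro!: nn_integral_cong simp: mult_ac split: split_indicator)
  also have "(\<integral>\<^sup>+t. ennreal (indicator {0..1} t * (t powr (q - 1) * (1 - t) powr (p - 1))) \<partial>lborel) = ennreal (Beta q p)"
    using has_integral_Beta_real[OF pq(2,1)]
    by (subst nn_integral_has_integral_lebesgue[symmetric, where \<Omega> = "{0..1}"])
       (auto simp: nn_integral_completion)
  also have "ennreal C * ennreal (Beta q p) = ennreal (C * Beta q p)"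
    using C by (simp add: ennreal_mult')
  also have "C * Beta q p = chisq_density (a + b) x"
    using G True unfolding C_def Beta_def chisq_density_def
    by (simp add: p_def q_def add_divide_distrib add.commute)
  finally show ?thesis .
qed

lemma ennreal_Cauchy_product:
  fixes F :: "nat \<Rightarrow> nat \<Rightarrow> ennreal"
  shows "(\<Sum>k. \<Sum>l. F k l) = (\<Sum>n. \<Sum>k\<le>n. F k (n - k))"
proof -
  have shift: "(\<Sum>l. F k l) = (\<Sum>n. if k \<le> n then F k (n - k) else 0)" for k
  proof -
    have "(\<Sum>n. if k \<le> n then F k (n - k) else 0) =
      (\<Sum>n. if k \<le> n + k then F k (n + k - k) else 0) + (\<Sum>n<k. if k \<le> n then F k (n - k) else 0)"
      by (rule suminf_offset) auto
    then show ?thesis by simp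
  qed
  have "(\<Sum>k. \<Sum>l. F k l) = (\<integral>\<^sup>+k. (\<Sum>n. if k \<le> n then F k (n - k) else 0) \<partial>count_space UNIV)"
    by (simp add: shift nn_integral_count_space_nat)
  also have "\<dots> = (\<Sum>n. \<integral>\<^sup>+k. (if k \<le> n then F k (n - k) else 0) \<partial>count_space UNIV)"
    by (rule nn_integral_suminf) simp
  also have "\<dots> = (\<Sum>n. \<Sum>k. (if k \<le> n then F k (n - k) else 0))"
    by (simp add: nn_integral_count_space_nat)
  also have "\<dots> = (\<Sum>n. \<Sum>k\<le>n. F k (n - k))"
    by (intro suminf_cong, subst suminf_finite[where N = "{..n}" for n]) auto
  finally show ?thesis .
qed

text \<open>
  Degrees of freedom and noncentralities both add: the double series is grouped by the total of the two
  Poisson indices, on which the central densities add their degrees of freedom, while the Poisson weights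
  convolve to the Poisson weights of the summed mean.
\<close>
lemma ncchisq_convolution:
  assumes "a > 0" "b > 0" "0 \<le> \<delta>" "0 \<le> \<epsilon>"
  shows "(\<integral>\<^sup>+y. ennreal (ncchisq_density a \<delta> (x - y)) * ennreal (ncchisq_density b \<epsilon> y) \<partial>lborel)
     = ennreal (ncchisq_density (a + b) (\<delta> + \<epsilon>) x)" (is "?L = _")
proof -
  have "?L = (\<integral>\<^sup>+y. (\<Sum>k. \<Sum>l. ennreal (pois \<delta> k) * ennreal (pois \<epsilon> l) *
      (ennreal (chisq_density (a + 2 * k) (x - y)) * ennreal (chisq_density (b + 2 * l) y))) \<partial>lborel)"
    using assms by (intro nn_integral_cong)
      (simp add: ennreal_ncchisq ennreal_suminf_cmult ennreal_suminf_multc[symmetric] mult_ac flip: ennreal_suminf_cmult)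
  also have "\<dots> = (\<Sum>k. \<Sum>l. \<integral>\<^sup>+y. ennreal (pois \<delta> k) * ennreal (pois \<epsilon> l) *
      (ennreal (chisq_density (a + 2 * k) (x - y)) * ennreal (chisq_density (b + 2 * l) y)) \<partial>lborel)"
    by (simp add: nn_integral_suminf)
  also have "\<dots> = (\<Sum>k. \<Sum>l. ennreal (pois \<delta> k * pois \<epsilon> l) * ennreal (chisq_density (a + b + 2 * (k + l)) x))"
  proof (intro suminf_cong)
    fix k l
    have "a + 2 * k + (b + 2 * l) = a + b + 2 * (k + l)" by simp
    then have "(\<integral>\<^sup>+y. ennreal (chisq_density (a + 2 * k) (x - y)) * ennreal (chisq_density (b + 2 * l) y) \<partial>lborel)
      = ennreal (chisq_density (a + b + 2 * (k + l)) x)"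
      using chisq_convolution[of "a + 2 * k" "b + 2 * l" x] assms by (metis add_gr_0)
    then show "(\<integral>\<^sup>+y. ennreal (pois \<delta> k) * ennreal (pois \<epsilon> l) *
      (ennreal (chisq_density (a + 2 * k) (x - y)) * ennreal (chisq_density (b + 2 * l) y)) \<partial>lborel)
      = ennreal (pois \<delta> k * pois \<epsilon> l) * ennreal (chisq_density (a + b + 2 * (k + l)) x)"
      using assms by (simp add: nn_integral_cmult ennreal_mult)
  qed
  also have "\<dots> = (\<Sum>n. \<Sum>k\<le>n. ennreal (pois \<delta> k * pois \<epsilon> (n - k)) * ennreal (chisq_density (a + b + 2 * n) x))"
    by (subst ennreal_Cauchy_product) auto
  also have "\<dots> = (\<Sum>n. ennreal (pois (\<delta> + \<epsilon>) n) * ennreal (chisq_density (a + b + 2 * n) x))"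
    using assms by (intro suminf_cong) (simp add: sum_distrib_right[symmetric] sum_ennreal pois_convolution)
  also have "\<dots> = ennreal (ncchisq_density (a + b) (\<delta> + \<epsilon>) x)"
    using assms by (simp add: ennreal_ncchisq)
  finally show ?thesis .
qed

section \<open>Sums of squares of independent normal variables\<close>

text \<open>
  The square map is not injective on the line, so the substitution is made on \<open>[0, n]\<close> and \<open>n\<close> is sent
  to infinity; integrands with a singularity at the origin are admitted.
\<close>
lemma nn_integral_square_substitution:
  fixes f :: "real \<Rightarrow> ennreal"
  assumes [measurable]: "f \<in> borel_measurable borel"
  shows "(\<integral>\<^sup>+w. f w * indicator {0..} w \<partial>lborel) = (\<integral>\<^sup>+z. f (z\<^sup>2) * ennreal (2 * z) * indicator {0..} z \<partial>lborel)"
proof -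
  have step: "(\<integral>\<^sup>+w. f w * indicator {0..(Suc n)\<^sup>2} w \<partial>lborel) = (\<integral>\<^sup>+z. f (z\<^sup>2) * ennreal (2 * z) * indicator {0..Suc n} z \<partial>lborel)" for n :: nat
  proof -
    have "((\<lambda>z. z\<^sup>2) has_real_derivative 2 * x) (at x)" for x :: real
      by (auto intro!: derivative_eq_intros)
    then show ?thesis
      using nn_integral_substitution_aux[of f 0 "Suc n" "\<lambda>z. z\<^sup>2" "\<lambda>z. 2 * z"]
      by (auto intro!: continuous_intros)
  qed
  have "(\<integral>\<^sup>+w. f w * indicator {0..} w \<partial>lborel) = emeasure (density lborel f) (\<Union>n::nat. {0..(real (Suc n))\<^sup>2})"
  proof (subst emeasure_density)
    have "(\<Union>n::nat. {0..(real (Suc n))\<^sup>2}) = {0..}"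
    proof safe
      fix x :: real assume "0 \<le> x"
      obtain n where n: "x \<le> real n" using real_arch_simple by blast
      have "real n \<le> (real (Suc n))\<^sup>2" by (simp add: power2_eq_square algebra_simps)
      then show "x \<in> (\<Union>n::nat. {0..(real (Suc n))\<^sup>2})" using \<open>0 \<le> x\<close> n by (auto intro!: exI[of _ n])
    qed auto
    then show "(\<integral>\<^sup>+w. f w * indicator {0..} w \<partial>lborel) = (\<integral>\<^sup>+w. f w * indicator (\<Union>n::nat. {0..(real (Suc n))\<^sup>2}) w \<partial>lborel)"
      by simp
  qed simp_all
  also have "\<dots> = (SUP n. emeasure (density lborel f) {0..(real (Suc n))\<^sup>2})"
    by (rule SUP_emeasure_incseq[symmetric]) (auto simp: incseq_def intro!: power_mono elim!: order_trans)
  also have "\<dots> = (SUP n. emeasure (density lborel (\<lambda>z. f (z\<^sup>2) * ennreal (2 * z))) {0..real (Suc n)})"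
    using step by (simp add: emeasure_density)
  also have "\<dots> = emeasure (density lborel (\<lambda>z. f (z\<^sup>2) * ennreal (2 * z))) (\<Union>n. {0..real (Suc n)})"
    by (rule SUP_emeasure_incseq) (auto simp: incseq_def)
  also have "(\<Union>n. {0..real (Suc n)}) = {0..}"
  proof safe
    fix x :: real assume "0 \<le> x"
    obtain n where n: "x \<le> real n" using real_arch_simple by blast
    then show "x \<in> (\<Union>n. {0..real (Suc n)})" using \<open>0 \<le> x\<close> by (auto intro!: exI[of _ n])
  qed auto
  finally show ?thesis by (simp add: emeasure_density)
qed

lemma Gamma_half_plus_nat: "Gamma (real k + 1 / 2) = fact (2 * k) * sqrt pi / (4 ^ k * fact k)"
proof (induction k)
  case (Suc k)
  have "Gamma (real (Suc k) + 1 / 2) = Gamma ((real k + 1 / 2) + 1)" by (simp add: add_ac)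
  also have "\<dots> = (real k + 1 / 2) * Gamma (real k + 1 / 2)"
    by (intro Gamma_plus1) (auto elim!: nonpos_Ints_cases)
  also have "\<dots> = (real k + 1 / 2) * (fact (2 * k) * sqrt pi / (4 ^ k * fact k))"
    by (simp only: Suc)
  also have "\<dots> = fact (2 * Suc k) * sqrt pi / (4 ^ Suc k * fact (Suc k))"
    by (simp add: divide_simps) (simp add: algebra_simps)
  finally show ?case .
qed (simp add: Gamma_one_half_real)

text \<open>
  Both points \<open>z\<close> and \<open>- z\<close> contribute to the density of the square of a normal variable. Their sum
  is a Gaussian factor times \<open>cosh (\<mu> * z)\<close>, and the power series of the hyperbolic cosine is term by term
  the Poisson series, because \<open>Gamma (k + 1 / 2)\<close> is an elementary multiple of \<open>fact (2 * k) / fact k\<close>.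
\<close>
lemma ncchisq_1_square:
  assumes "z > 0"
  shows "ncchisq_density 1 (\<mu>\<^sup>2) (z\<^sup>2) * (2 * z) = normal_density \<mu> 1 z + normal_density \<mu> 1 (- z)"
proof -
  define C where "C = 1 / sqrt (2 * pi) * exp (- (\<mu>\<^sup>2 + z\<^sup>2) / 2)"
  have "(\<lambda>n. if even n then (\<mu> * z) ^ n /\<^sub>R fact n else 0) sums cosh (\<mu> * z)"
    by (rule cosh_converges)
  then have "(\<lambda>k. if even (2 * k) then (\<mu> * z) ^ (2 * k) /\<^sub>R fact (2 * k) else 0) sums cosh (\<mu> * z)"
    by (subst sums_mono_reindex[of "\<lambda>k. 2 * k"]) (auto simp: strict_mono_def elim!: evenE)
  then have "(\<lambda>k. 2 * C * ((\<mu> * z) ^ (2 * k) / fact (2 * k))) sums (2 * C * cosh (\<mu> * z))"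
    by (intro sums_mult) (simp add: divide_inverse_commute)
  moreover have "pois (\<mu>\<^sup>2) k * chisq_density (1 + 2 * k) (z\<^sup>2) * (2 * z) = 2 * C * ((\<mu> * z) ^ (2 * k) / fact (2 * k))" for k
  proof -
    have "(z\<^sup>2) powr (real (1 + 2 * k) / 2 - 1) = z powr (2 * (real k - 1 / 2))"
    proof -
      have "z\<^sup>2 = z powr 2" using assms by simp
      moreover have "real (1 + 2 * k) / 2 - 1 = real k - 1 / 2" by (simp add: field_simps)
      ultimately show ?thesis by (simp only: powr_powr)
    qed
    also have "2 * (real k - 1 / 2) = real (2 * k) - 1" by simp
    also have "z powr (real (2 * k) - 1) = z ^ (2 * k) / z"
      using assms by (subst powr_diff) (simp add: powr_realpow del: of_nat_mult)
    finally have 1: "(z\<^sup>2) powr (real (1 + 2 * k) / 2 - 1) = z ^ (2 * k) / z" .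
    have 2: "(2::real) powr (real (1 + 2 * k) / 2) = sqrt 2 * 2 ^ k"
      by (simp add: add_divide_distrib powr_add powr_half_sqrt powr_realpow)
    have 3: "Gamma (real (1 + 2 * k) / 2) = fact (2 * k) * sqrt pi / (4 ^ k * fact k)"
      using Gamma_half_plus_nat[of k] by (simp add: add_divide_distrib add.commute)
    have 4: "(\<mu>\<^sup>2 / 2) ^ k = \<mu> ^ (2 * k) / 2 ^ k" by (simp add: power_divide power_mult)
    have 5: "(4::real) ^ k = 2 ^ k * 2 ^ k" by (simp flip: power_mult_distrib)
    have "pois (\<mu>\<^sup>2) k * chisq_density (1 + 2 * k) (z\<^sup>2) * (2 * z) =
      (\<mu> ^ (2 * k) / 2 ^ k / fact k * exp (- \<mu>\<^sup>2 / 2)) *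
      (z ^ (2 * k) / z * exp (- z\<^sup>2 / 2) / (sqrt 2 * 2 ^ k * (fact (2 * k) * sqrt pi / (2 ^ k * 2 ^ k * fact k)))) * (2 * z)"
      using assms unfolding pois_def chisq_density_def 1 2 3 4 5 by simp
    also have "\<dots> = 2 / (sqrt 2 * sqrt pi) * (exp (- \<mu>\<^sup>2 / 2) * exp (- z\<^sup>2 / 2)) * (\<mu> ^ (2 * k) * z ^ (2 * k) / fact (2 * k))"
      using assms by (simp add: field_simps)
    also have "exp (- \<mu>\<^sup>2 / 2) * exp (- z\<^sup>2 / 2) = exp (- (\<mu>\<^sup>2 + z\<^sup>2) / 2)"
      by (simp add: field_simps flip: exp_add)
    finally show ?thesis by (simp add: C_def real_sqrt_mult power_mult_distrib)
  qed
  ultimately have "(\<lambda>k. pois (\<mu>\<^sup>2) k * chisq_density (1 + 2 * k) (z\<^sup>2) * (2 * z)) sums (2 * C * cosh (\<mu> * z))"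
    by simp
  moreover have "(\<lambda>k. pois (\<mu>\<^sup>2) k * chisq_density (1 + 2 * k) (z\<^sup>2) * (2 * z)) sums (ncchisq_density 1 (\<mu>\<^sup>2) (z\<^sup>2) * (2 * z))"
    unfolding ncchisq_density_pois by (intro sums_mult2 summable_sums summable_ncchisq) simp
  ultimately have "ncchisq_density 1 (\<mu>\<^sup>2) (z\<^sup>2) * (2 * z) = 2 * C * cosh (\<mu> * z)"
    by (rule sums_unique2[symmetric])
  also have "\<dots> = normal_density \<mu> 1 z + normal_density \<mu> 1 (- z)"
    unfolding cosh_field_def C_def normal_density_def
    by (simp add: field_simps power2_eq_square flip: exp_add)
  finally show ?thesis .
qed

lemma ncchisq_density_nonpos: "w \<le> 0 \<Longrightarrow> ncchisq_density m \<delta> w = 0"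
  by (simp add: ncchisq_density_pois chisq_density_def)

lemma normal_square_ncchisq:
  "distr (density lborel (\<lambda>z. ennreal (normal_density \<mu> 1 z))) borel (\<lambda>z. z\<^sup>2) = ncchisq_distr 1 (\<mu>\<^sup>2)"
proof (rule measure_eqI)
  fix A :: "real set" assume "A \<in> sets (distr (density lborel (\<lambda>z. ennreal (normal_density \<mu> 1 z))) borel (\<lambda>z. z\<^sup>2))"
  then have [measurable]: "A \<in> sets borel" by simp
  let ?\<phi> = "normal_density \<mu> 1"
  let ?I = "\<lambda>z. indicator A (z\<^sup>2) :: ennreal"
  have "emeasure (distr (density lborel ?\<phi>) borel (\<lambda>z. z\<^sup>2)) A = (\<integral>\<^sup>+z. ?I z * ?\<phi> z \<partial>lborel)"
    by (subst nn_integral_indicator[symmetric], simp, subst nn_integral_distr, simp, simp, subst nn_integral_density)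
      (auto intro!: nn_integral_cong simp: mult.commute)
  also have "\<dots> = (\<integral>\<^sup>+z. ?I z * ?\<phi> z * indicator {0<..} z + ?I z * ?\<phi> z * indicator {..<0} z \<partial>lborel)"
    using AE_lborel_singleton[of "0::real"] by (intro nn_integral_cong_AE) (auto elim!: eventually_mono split: split_indicator)
  also have "\<dots> = (\<integral>\<^sup>+z. ?I z * ?\<phi> z * indicator {0<..} z \<partial>lborel) + (\<integral>\<^sup>+z. ?I z * ?\<phi> z * indicator {..<0} z \<partial>lborel)"
    by (subst nn_integral_add) auto
  also have "(\<integral>\<^sup>+z. ?I z * ?\<phi> z * indicator {..<0} z \<partial>lborel) = (\<integral>\<^sup>+z. ?I z * ?\<phi> (- z) * indicator {0<..} z \<partial>lborel)"
    by (subst nn_integral_real_affine[where c = "- 1" and t = 0])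
      (auto intro!: nn_integral_cong split: split_indicator)
  also have "(\<integral>\<^sup>+z. ?I z * ?\<phi> z * indicator {0<..} z \<partial>lborel) + (\<integral>\<^sup>+z. ?I z * ?\<phi> (- z) * indicator {0<..} z \<partial>lborel)
    = (\<integral>\<^sup>+z. ?I z * ?\<phi> z * indicator {0<..} z + ?I z * ?\<phi> (- z) * indicator {0<..} z \<partial>lborel)"
    by (subst nn_integral_add) auto
  also have "\<dots> = (\<integral>\<^sup>+z. (?I z * ennreal (ncchisq_density 1 (\<mu>\<^sup>2) (z\<^sup>2))) * ennreal (2 * z) * indicator {0..} z \<partial>lborel)"
  proof (intro nn_integral_cong)
    fix z :: real
    show "?I z * ?\<phi> z * indicator {0<..} z + ?I z * ?\<phi> (- z) * indicator {0<..} z =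
      (?I z * ennreal (ncchisq_density 1 (\<mu>\<^sup>2) (z\<^sup>2))) * ennreal (2 * z) * indicator {0..} z"
      using ncchisq_1_square[of z \<mu>] ncchisq_nonneg[of "\<mu>\<^sup>2" 1 "z\<^sup>2"]
      by (cases "z > 0"; cases "z = 0")
        (auto simp: ennreal_mult[symmetric] ennreal_plus[symmetric] simp del: ennreal_plus split: split_indicator)
  qed
  also have "\<dots> = (\<integral>\<^sup>+w. (indicator A w * ennreal (ncchisq_density 1 (\<mu>\<^sup>2) w)) * indicator {0..} w \<partial>lborel)"
    by (subst nn_integral_square_substitution) auto
  also have "\<dots> = emeasure (ncchisq_distr 1 (\<mu>\<^sup>2)) A"
    unfolding ncchisq_distr_def
    by (subst emeasure_density) (auto intro!: nn_integral_cong simp: ncchisq_density_nonpos split: split_indicator)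
  finally show "emeasure (distr (density lborel ?\<phi>) borel (\<lambda>z. z\<^sup>2)) A = emeasure (ncchisq_distr 1 (\<mu>\<^sup>2)) A" .
qed (simp add: ncchisq_distr_def)

lemma convolution_ncchisq:
  assumes "a > 0" "b > 0" "0 \<le> \<delta>" "0 \<le> \<epsilon>"
    and "finite_measure (ncchisq_distr a \<delta>)" "finite_measure (ncchisq_distr b \<epsilon>)"
  shows "convolution (ncchisq_distr a \<delta>) (ncchisq_distr b \<epsilon>) = ncchisq_distr (a + b) (\<delta> + \<epsilon>)"
  using assms(5,6) unfolding ncchisq_distr_def
  by (subst convolution_density) (simp_all add: ncchisq_convolution assms)

text \<open>
  Only the sum of the squared means matters. Integrating out one coordinate at a time makes the law of
  the sum a convolution, and noncentral chi-square laws are closed under convolution.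
\<close>
lemma sum_squares_normal_ncchisq:
  fixes \<mu> :: "'i \<Rightarrow> real"
  assumes "finite J" "J \<noteq> {}"
  shows "distr (PiM J (\<lambda>j. density lborel (\<lambda>z. ennreal (normal_density (\<mu> j) 1 z)))) borel (\<lambda>y. \<Sum>j\<in>J. (y j)\<^sup>2)
    = ncchisq_distr (card J) (\<Sum>j\<in>J. (\<mu> j)\<^sup>2)"
proof -
  define N where "N = (\<lambda>j. density lborel (\<lambda>z. ennreal (normal_density (\<mu> j) 1 z)))"
  have ps: "prob_space (N j)" for j unfolding N_def by (rule prob_space_normal_density) simp
  interpret product_prob_space N by (rule product_prob_spaceI) (rule ps)
  have [measurable_cong, simp]: "sets (N j) = sets borel" for j by (simp add: N_def)
  have bmN: "borel_measurable (N i) = (borel_measurable borel :: (real \<Rightarrow> ennreal) set)" for i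
    by (rule measurable_cong_sets) simp_all
  have sq [measurable, simp]: "(\<lambda>z::real. z\<^sup>2) \<in> borel_measurable (N i)" for i
    by (subst measurable_cong_sets[where M' = borel and N' = borel]) simp_all
  have sum_meas: "(\<lambda>y. \<Sum>j\<in>I. (y j)\<^sup>2) \<in> borel_measurable (PiM I N)" for I
  proof (intro borel_measurable_sum borel_measurable_power)
    fix i assume "i \<in> I"
    then have "(\<lambda>x. x i) \<in> PiM I N \<rightarrow>\<^sub>M N i" by (rule measurable_component_singleton)
    also have "PiM I N \<rightarrow>\<^sub>M N i = borel_measurable (PiM I N)" by (rule measurable_cong_sets) simp_all
    finally show "(\<lambda>x. x i) \<in> borel_measurable (PiM I N)" .
  qed
  have dist: "distr (PiM I N) borel (\<lambda>y. \<Sum>j\<in>I. (y j)\<^sup>2) = ncchisq_distr (card I) (\<Sum>j\<in>I. (\<mu> j)\<^sup>2) \<Longrightarrow>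
     finite_measure (ncchisq_distr (card I) (\<Sum>j\<in>I. (\<mu> j)\<^sup>2))" for I
    by (metis sum_meas prob_space_PiM ps prob_space.prob_space_distr prob_space.finite_measure)
  have N1: "distr (N i) borel (\<lambda>z. z\<^sup>2) = ncchisq_distr 1 ((\<mu> i)\<^sup>2)" for i
    unfolding N_def by (rule normal_square_ncchisq)
  have fin1: "finite_measure (ncchisq_distr 1 ((\<mu> i)\<^sup>2))" for i
    unfolding N1[symmetric] by (intro prob_space.finite_measure prob_space.prob_space_distr ps) simp
  have "distr (PiM J N) borel (\<lambda>y. \<Sum>j\<in>J. (y j)\<^sup>2) = ncchisq_distr (card J) (\<Sum>j\<in>J. (\<mu> j)\<^sup>2)"
    using assms
  proof (induction J rule: finite_ne_induct)
    case (singleton i)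
    have "distr (PiM {i} N) borel (\<lambda>y. \<Sum>j\<in>{i}. (y j)\<^sup>2) = distr (N i) borel (\<lambda>z. z\<^sup>2)"
    proof (rule measure_eqI)
      fix A assume "A \<in> sets (distr (PiM {i} N) borel (\<lambda>y. \<Sum>j\<in>{i}. (y j)\<^sup>2))"
      then have [measurable]: "A \<in> sets borel" by simp
      have ind: "(\<lambda>y. indicator A (y\<^sup>2) :: ennreal) \<in> borel_measurable (N i)"
        unfolding bmN by measurable
      have "(\<lambda>x. x i) \<in> PiM {i} N \<rightarrow>\<^sub>M N i" by (rule measurable_component_singleton) simp
      also have "PiM {i} N \<rightarrow>\<^sub>M N i = borel_measurable (PiM {i} N)" by (rule measurable_cong_sets) simp_all
      finally have [measurable]: "(\<lambda>x. x i) \<in> borel_measurable (PiM {i} N)" .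
      have "emeasure (distr (PiM {i} N) borel (\<lambda>y. \<Sum>j\<in>{i}. (y j)\<^sup>2)) A = (\<integral>\<^sup>+y. indicator A ((y i)\<^sup>2) \<partial>PiM {i} N)"
        by (subst nn_integral_indicator[symmetric], simp, subst nn_integral_distr) auto
      also have "\<dots> = (\<integral>\<^sup>+y. indicator A (y\<^sup>2) \<partial>N i)"
        using ind by (intro product_nn_integral_singleton[where f = "\<lambda>y. indicator A (y\<^sup>2)"])
      also have "\<dots> = emeasure (distr (N i) borel (\<lambda>z. z\<^sup>2)) A"
        by (subst nn_integral_indicator[symmetric], simp, subst nn_integral_distr) auto
      finally show "emeasure (distr (PiM {i} N) borel (\<lambda>y. \<Sum>j\<in>{i}. (y j)\<^sup>2)) A = emeasure (distr (N i) borel (\<lambda>z. z\<^sup>2)) A" .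
    qed simp
    then show ?case by (simp add: N1)
  next
    case (insert i I)
    note [measurable] = sum_meas[of I] sum_meas[of "insert i I"]
    have pos: "0 \<le> (\<Sum>j\<in>I. (\<mu> j)\<^sup>2)" by (intro sum_nonneg) simp
    note finI = dist[OF insert.IH]
    have "distr (PiM (insert i I) N) borel (\<lambda>y. \<Sum>j\<in>insert i I. (y j)\<^sup>2) =
       convolution (ncchisq_distr (card I) (\<Sum>j\<in>I. (\<mu> j)\<^sup>2)) (ncchisq_distr 1 ((\<mu> i)\<^sup>2))" (is "?L = ?R")
    proof (rule measure_eqI)
      fix A assume "A \<in> sets ?L"
      then have [measurable]: "A \<in> sets borel" by simp
      have "emeasure ?L A = (\<integral>\<^sup>+y. indicator A (\<Sum>j\<in>insert i I. (y j)\<^sup>2) \<partial>PiM (insert i I) N)"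
        by (subst nn_integral_indicator[symmetric], simp, subst nn_integral_distr) auto
      also have "\<dots> = (\<integral>\<^sup>+x. (\<integral>\<^sup>+y. indicator A (\<Sum>j\<in>insert i I. ((x(i := y)) j)\<^sup>2) \<partial>N i) \<partial>PiM I N)"
        using insert by (intro product_nn_integral_insert) auto
      also have "\<dots> = (\<integral>\<^sup>+x. (\<integral>\<^sup>+y. indicator A ((\<Sum>j\<in>I. (x j)\<^sup>2) + y\<^sup>2) \<partial>N i) \<partial>PiM I N)"
      proof (intro nn_integral_cong arg_cong[where f = "indicator A"])
        fix x :: "'i \<Rightarrow> real" and y
        have "(\<Sum>j\<in>I. ((x(i := y)) j)\<^sup>2) = (\<Sum>j\<in>I. (x j)\<^sup>2)"
          using insert by (intro sum.cong) auto
        then show "(\<Sum>j\<in>insert i I. ((x(i := y)) j)\<^sup>2) = (\<Sum>j\<in>I. (x j)\<^sup>2) + y\<^sup>2"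
          using insert by simp
      qed
      also have "\<dots> = (\<integral>\<^sup>+x. (\<integral>\<^sup>+b. indicator A ((\<Sum>j\<in>I. (x j)\<^sup>2) + b) \<partial>distr (N i) borel (\<lambda>z. z\<^sup>2)) \<partial>PiM I N)"
        by (subst nn_integral_distr) auto
      also have "\<dots> = (\<integral>\<^sup>+a. (\<integral>\<^sup>+b. indicator A (a + b) \<partial>distr (N i) borel (\<lambda>z. z\<^sup>2)) \<partial>distr (PiM I N) borel (\<lambda>y. \<Sum>j\<in>I. (y j)\<^sup>2))"
      proof -
        interpret F: finite_measure "distr (N i) borel (\<lambda>z. z\<^sup>2)" using fin1 N1 by simp
        show ?thesis by (subst nn_integral_distr[where M' = borel and M = "PiM I N"]) auto
      qed
      also have "\<dots> = emeasure ?R A"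
        unfolding N1 insert.IH
        by (rule convolution_emeasure'[symmetric]) (use finI fin1 in \<open>auto simp: ncchisq_distr_def\<close>)
      finally show "emeasure ?L A = emeasure ?R A" .
    qed simp
    also have "?R = ncchisq_distr (card (insert i I)) (\<Sum>j\<in>insert i I. (\<mu> j)\<^sup>2)"
      using insert pos finI fin1 by (subst convolution_ncchisq) (auto simp: card_gt_0_iff add.commute)
    finally show ?case .
  qed
  then show ?thesis unfolding N_def .
qed

section \<open>Lebesgue measure on spaces of vectors and matrices\<close>

text \<open>
  Uniqueness of Haar measure for \<open>\<real>\<^sup>n\<close>. The double integral of \<open>f x * g y\<close> against \<open>\<mu>\<close> and Lebesgue
  measure is computed in two ways by translating each variable by the other; with \<open>g\<close> the indicator of the
  unit ball, which is symmetric, the two measures are seen to be proportional with the ratio of their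
  values at the ball.
\<close>
lemma lborel_eq_translation_invariant:
  fixes \<mu> :: "'a::euclidean_space measure"
  assumes sets [measurable_cong, simp]: "sets \<mu> = sets borel" and sf: "sigma_finite_measure \<mu>"
    and trans: "\<And>a. distr \<mu> borel (\<lambda>x. x + a) = \<mu>"
    and ball: "emeasure \<mu> (ball 0 1) = emeasure lborel (ball (0::'a) 1)"
  shows "\<mu> = lborel"
proof (rule measure_eqI)
  fix A assume "A \<in> sets \<mu>"
  then have [measurable]: "A \<in> sets borel" by simp
  interpret M: sigma_finite_measure \<mu> by fact
  interpret pair_sigma_finite \<mu> "lborel :: 'a measure" ..
  have T: "(\<integral>\<^sup>+x. h (x + a) \<partial>\<mu>) = (\<integral>\<^sup>+x. h x \<partial>\<mu>)" if [measurable]: "h \<in> borel_measurable borel" for h :: "'a \<Rightarrow> ennreal" and a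
    by (subst (2) trans[of a, symmetric], subst nn_integral_distr) auto
  have L: "(\<integral>\<^sup>+y. h (y + a) \<partial>lborel) = (\<integral>\<^sup>+y. h y \<partial>lborel)" if [measurable]: "h \<in> borel_measurable borel" for h :: "'a \<Rightarrow> ennreal" and a
    by (subst (2) lborel_distr_plus[of a, symmetric], subst nn_integral_distr) (auto simp: add.commute)
  define f where "f = (indicator A :: 'a \<Rightarrow> ennreal)"
  define g where "g = (indicator (ball 0 1) :: 'a \<Rightarrow> ennreal)"
  have [measurable]: "f \<in> borel_measurable borel" "g \<in> borel_measurable borel" unfolding f_def g_def by (simp, intro borel_measurable_indicator borel_open open_ball)
  have If: "(\<integral>\<^sup>+x. f x \<partial>\<mu>) = emeasure \<mu> A" "(\<integral>\<^sup>+x. f x \<partial>lborel) = emeasure lborel A"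
    and Ig: "(\<integral>\<^sup>+x. g x \<partial>\<mu>) = emeasure \<mu> (ball 0 1)" "(\<integral>\<^sup>+x. g x \<partial>lborel) = emeasure lborel (ball (0::'a) 1)"
    by (simp_all add: f_def g_def)
  let ?b = "emeasure lborel (ball (0::'a) 1)"
  have "emeasure \<mu> A * ?b = (\<integral>\<^sup>+y. (\<integral>\<^sup>+x. f x * g y \<partial>\<mu>) \<partial>lborel)"
    by (subst nn_integral_multc, simp, subst nn_integral_cmult) (simp_all add: If Ig)
  also have "\<dots> = (\<integral>\<^sup>+y. (\<integral>\<^sup>+x. f (x + y) * g y \<partial>\<mu>) \<partial>lborel)"
    using T[of "\<lambda>x. f x * g y" y for y] by simp
  also have "\<dots> = (\<integral>\<^sup>+x. (\<integral>\<^sup>+y. f (x + y) * g y \<partial>lborel) \<partial>\<mu>)"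
    by (rule Fubini') measurable
  also have "\<dots> = (\<integral>\<^sup>+x. (\<integral>\<^sup>+y. f y * g (y - x) \<partial>lborel) \<partial>\<mu>)"
    using L[of "\<lambda>y. f y * g (y - x)" x for x] by (simp add: add.commute)
  also have "\<dots> = (\<integral>\<^sup>+y. (\<integral>\<^sup>+x. f y * g (y - x) \<partial>\<mu>) \<partial>lborel)"
    by (rule Fubini'[symmetric]) measurable
  also have "\<dots> = (\<integral>\<^sup>+y. (\<integral>\<^sup>+x. f y * g (- x) \<partial>\<mu>) \<partial>lborel)"
    using T[of "\<lambda>x. f y * g (y - x)" y for y] by simp
  \<comment> \<open>the unit ball is symmetric\<close>
  also have "(\<lambda>x. g (- x)) = g" by (auto simp: g_def fun_eq_iff split: split_indicator)
  then have "(\<integral>\<^sup>+y. (\<integral>\<^sup>+x. f y * g (- x) \<partial>\<mu>) \<partial>lborel) = emeasure lborel A * ?b"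
    by (subst nn_integral_cmult) (auto simp: fun_eq_iff nn_integral_multc ball[symmetric] If Ig)
  finally have "emeasure \<mu> A * ?b = emeasure lborel A * ?b" .
  moreover have "?b \<noteq> 0" "?b \<noteq> top" by (simp_all add: emeasure_ball less_imp_neq[OF unit_ball_vol_pos, symmetric])
  ultimately show "emeasure \<mu> A = emeasure lborel A"
    using ennreal_mult_cancel_left[of ?b] by (metis mult.commute)
qed simp

text \<open>
  An isometry preserves balls and carries translations to translations, so the image of Lebesgue measure
  is again translation invariant with the right value at the unit ball. Both spaces may differ, so that
  this covers rotations as well as the identification of a matrix with its pair of column blocks.
\<close>
lemma distr_lborel_isometry:
  fixes T :: "'a::euclidean_space \<Rightarrow> 'b::euclidean_space"
  assumes lin: "linear T" and norm: "\<And>x. norm (T x) = norm x" and surj: "surj T"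
  shows "distr lborel borel T = lborel"
proof (rule lborel_eq_translation_invariant)
  have [measurable]: "T \<in> borel \<rightarrow>\<^sub>M borel"
    using lin by (intro borel_measurable_continuous_onI linear_continuous_on) (simp add: linear_conv_bounded_linear)
  have pre: "T -` ball 0 r = ball 0 r" for r by (auto simp: norm)
  have "inj T" using lin norm by (metis linear_injective_0 norm_eq_zero)
  then have "dim (range T) = DIM('a)" using lin by (metis dim_UNIV dim_image_eq inj_on_subset subset_UNIV)
  then have "DIM('a) = DIM('b)" using surj by (simp add: dim_UNIV)
  then show "emeasure (distr lborel borel T) (ball 0 1) = emeasure lborel (ball (0::'b) 1)"
    by (simp add: emeasure_distr pre emeasure_ball)
  show "sigma_finite_measure (distr lborel borel T)"
  proof (standard, intro exI[of _ "range (\<lambda>n::nat. ball 0 (real n))"] conjI ballI)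
    show "\<Union>(range (\<lambda>n::nat. ball 0 (real n))) = space (distr lborel borel T)"
      using reals_Archimedean2 by (fastforce simp: )
  qed (auto simp: emeasure_distr pre emeasure_ball)
  fix a
  obtain c where c: "a = T c" using surj by blast
  have "distr (distr lborel borel T) borel (\<lambda>x. x + a) = distr lborel borel (\<lambda>x. T (c + x))"
    by (subst distr_distr) (auto simp: o_def c linear_add[OF lin] add.commute)
  also have "\<dots> = distr (distr lborel borel ((+) c)) borel T"
    by (subst distr_distr) (auto simp: o_def)
  finally show "distr (distr lborel borel T) borel (\<lambda>x. x + a) = distr lborel borel T"
    by (simp add: lborel_distr_plus)
qed simp

text \<open>
  By Fubini's theorem some single translate of the exceptional set is null, and Lebesgue measure does not
  notice translations. A fixed direction \<open>D\<close> therefore suffices, without any choice of coordinates.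
\<close>
lemma AE_lborel_along_lines:
  fixes D :: "'a::euclidean_space"
  assumes [measurable]: "Measurable.pred borel P"
    and lines: "AE x in lborel. AE t in lborel. P (x + t *\<^sub>R D)"
  shows "AE x in lborel. P x"
proof -
  have "AE t in (lborel :: real measure). AE x in lborel. P (x + t *\<^sub>R D)"
    using lines by (subst lborel_pair.AE_commute[symmetric]) measurable
  then obtain t :: real where "AE x in lborel. P (x + t *\<^sub>R D)"
    using eventually_happens[of _ "ae_filter (lborel :: real measure)"]
    by (auto simp: ae_filter_eq_bot_iff)
  then have "AE x in distr lborel borel ((+) (t *\<^sub>R D)). P x"
    by (subst AE_distr_iff) (auto simp: add.commute)
  then show ?thesis using lborel_distr_plus[of "t *\<^sub>R D"] by metis
qed

lemma vec_lambda_measurable_PiM [measurable]: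
  "(vec_lambda :: ('n::finite \<Rightarrow> 'e::euclidean_space) \<Rightarrow> _) \<in> PiM UNIV (\<lambda>_. borel) \<rightarrow>\<^sub>M borel"
proof (subst borel_measurable_euclidean_space, intro ballI)
  fix b :: "'e ^ 'n" assume "b \<in> Basis"
  then obtain i e where b: "b = axis i e" "e \<in> Basis" by (auto simp: Basis_vec_def)
  show "(\<lambda>x. vec_lambda x \<bullet> b) \<in> borel_measurable (PiM UNIV (\<lambda>_. borel :: 'e measure))"
    by (simp add: b inner_axis)
qed

lemma borel_measurable_vecI:
  fixes f :: "'a \<Rightarrow> 'e::euclidean_space ^ 'n::finite"
  assumes "\<And>i. (\<lambda>x. f x $ i) \<in> borel_measurable M"
  shows "f \<in> borel_measurable M"
proof (subst borel_measurable_euclidean_space, intro ballI)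
  fix b :: "'e ^ 'n" assume "b \<in> Basis"
  then obtain i e where b: "b = axis i e" "e \<in> Basis" by (auto simp: Basis_vec_def)
  show "(\<lambda>x. f x \<bullet> b) \<in> borel_measurable M"
    using assms[of i] by (simp add: b inner_axis)
qed

lemma vec_nth_borel_measurable [measurable (raw)]:
  fixes f :: "'a \<Rightarrow> 'e::euclidean_space ^ 'n::finite"
  assumes "f \<in> borel_measurable M"
  shows "(\<lambda>x. f x $ i) \<in> borel_measurable M"
  by (rule measurable_compose[OF assms borel_measurable_continuous_onI]) (intro continuous_intros)

lemma distr_vec_lambda_lborel:
  "distr (PiM UNIV (\<lambda>_::'n::finite. lborel :: 'e::euclidean_space measure)) borel vec_lambda = lborel"
proof (rule lborel_eqI[symmetric])
  interpret product_sigma_finite "\<lambda>_::'n. lborel :: 'e measure" ..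
  have [measurable]: "(vec_lambda :: ('n \<Rightarrow> 'e) \<Rightarrow> _) \<in> PiM UNIV (\<lambda>_. lborel) \<rightarrow>\<^sub>M borel"
    using vec_lambda_measurable_PiM by (simp cong: measurable_cong_sets sets_PiM_cong)
  fix l u :: "'e ^ 'n" assume le: "\<And>b. b \<in> Basis \<Longrightarrow> l \<bullet> b \<le> u \<bullet> b"
  have le': "l $ i \<bullet> e \<le> u $ i \<bullet> e" if "e \<in> Basis" for i e
    using le[of "axis i e"] that by (auto simp: Basis_vec_def inner_axis)
  have pre: "vec_lambda -` box l u \<inter> space (PiM UNIV (\<lambda>_::'n. lborel :: 'e measure)) = Pi\<^sub>E UNIV (\<lambda>i. box (l $ i) (u $ i))"
    by (auto simp: mem_box Basis_vec_def inner_axis space_PiM PiE_UNIV_domain Pi_iff)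
  have "emeasure (distr (PiM UNIV (\<lambda>_. lborel)) borel vec_lambda) (box l u) = (\<Prod>i\<in>UNIV. emeasure lborel (box (l $ i) (u $ i)))"
    by (subst emeasure_distr, simp, simp, subst pre, subst emeasure_PiM) auto
  also have "\<dots> = (\<Prod>i\<in>UNIV. ennreal (\<Prod>e\<in>Basis. (u $ i - l $ i) \<bullet> e))"
    using le' by (simp add: emeasure_lborel_box_eq)
  also have "\<dots> = ennreal (\<Prod>i\<in>UNIV. \<Prod>e\<in>Basis. (u $ i - l $ i) \<bullet> e)"
    using le' by (intro prod_ennreal) (auto intro!: prod_nonneg simp: inner_diff_left)
  also have "(\<Prod>i\<in>UNIV. \<Prod>e\<in>Basis. (u $ i - l $ i) \<bullet> e) = (\<Prod>b\<in>Basis. (u - l) \<bullet> b)"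
  proof -
    have B: "(Basis :: ('e ^ 'n) set) = (\<lambda>(i, e). axis i e) ` (UNIV \<times> Basis)"
      by (auto simp: Basis_vec_def)
    have "inj_on (\<lambda>(i::'n, e::'e). axis i e) (UNIV \<times> Basis)"
      by (auto simp: inj_on_def axis_eq_axis)
    then show ?thesis
      unfolding B by (subst prod.reindex) (auto simp: prod.cartesian_product inner_axis split_beta)
  qed
  finally show "emeasure (distr (PiM UNIV (\<lambda>_. lborel)) borel vec_lambda) (box l u) = (\<Prod>b\<in>Basis. (u - l) \<bullet> b)" .
qed simp

lemma PiM_density_lborel:
  fixes f :: "'i \<Rightarrow> 'e::euclidean_space \<Rightarrow> ennreal"
  assumes "finite I" and f [measurable]: "\<And>i. f i \<in> borel_measurable borel"
    and sf: "\<And>i. sigma_finite_measure (density lborel (f i))"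
  shows "PiM I (\<lambda>i. density lborel (f i)) = density (PiM I (\<lambda>_. lborel)) (\<lambda>x. \<Prod>i\<in>I. f i (x i))"
proof -
  interpret L: product_sigma_finite "\<lambda>_::'i. lborel :: 'e measure" ..
  interpret D: product_sigma_finite "\<lambda>i. density lborel (f i)" by (rule product_sigma_finite.intro) (rule sf)
  show ?thesis
  proof (rule D.PiM_eqI[symmetric])
    show "sets (density (PiM I (\<lambda>_. lborel)) (\<lambda>x. \<Prod>i\<in>I. f i (x i))) = sets (PiM I (\<lambda>i. density lborel (f i)))"
      by (simp cong: sets_PiM_cong)
    fix A :: "'i \<Rightarrow> 'e set" assume "\<And>i. i \<in> I \<Longrightarrow> A i \<in> sets (density lborel (f i))"
    then have A: "\<And>i. i \<in> I \<Longrightarrow> A i \<in> sets borel" by simp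
    have "emeasure (density (PiM I (\<lambda>_. lborel)) (\<lambda>x. \<Prod>i\<in>I. f i (x i))) (Pi\<^sub>E I A) =
      (\<integral>\<^sup>+x. (\<Prod>i\<in>I. f i (x i)) * indicator (Pi\<^sub>E I A) x \<partial>PiM I (\<lambda>_. lborel))"
      using A assms(1) by (subst emeasure_density) (auto intro!: sets_PiM_I_finite)
    also have "\<dots> = (\<integral>\<^sup>+x. (\<Prod>i\<in>I. f i (x i) * indicator (A i) (x i)) \<partial>PiM I (\<lambda>_. lborel))"
    proof (intro nn_integral_cong)
      fix x assume "x \<in> space (PiM I (\<lambda>_. lborel :: 'e measure))"
      then have "x \<in> extensional I" by (simp add: space_PiM PiE_def)
      then have "indicator (Pi\<^sub>E I A) x = (\<Prod>i\<in>I. indicator (A i) (x i) :: ennreal)"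
        using assms(1) by (auto simp: indicator_def PiE_iff)
      then show "(\<Prod>i\<in>I. f i (x i)) * indicator (Pi\<^sub>E I A) x = (\<Prod>i\<in>I. f i (x i) * indicator (A i) (x i))"
        by (simp add: prod.distrib)
    qed
    also have "\<dots> = (\<Prod>i\<in>I. \<integral>\<^sup>+x. f i x * indicator (A i) x \<partial>lborel)"
      using A assms(1) by (intro L.product_nn_integral_prod) auto
    also have "\<dots> = (\<Prod>i\<in>I. emeasure (density lborel (f i)) (A i))"
      using A by (intro prod.cong) (auto simp: emeasure_density)
    finally show "emeasure (density (PiM I (\<lambda>_. lborel)) (\<lambda>x. \<Prod>i\<in>I. f i (x i))) (Pi\<^sub>E I A) =
      (\<Prod>i\<in>I. emeasure (density lborel (f i)) (A i))" .
  qed fact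
qed

lemma distr_PiM_density_vec_lambda:
  fixes f :: "'n::finite \<Rightarrow> 'e::euclidean_space \<Rightarrow> ennreal"
  assumes f [measurable]: "\<And>i. f i \<in> borel_measurable borel"
    and sf: "\<And>i. sigma_finite_measure (density lborel (f i))"
  shows "distr (PiM UNIV (\<lambda>i. density lborel (f i))) borel vec_lambda = density lborel (\<lambda>x. \<Prod>i\<in>UNIV. f i (x $ i))"
proof -
  have [measurable]: "(vec_lambda :: ('n \<Rightarrow> 'e) \<Rightarrow> _) \<in> PiM UNIV (\<lambda>_. lborel) \<rightarrow>\<^sub>M borel"
    using vec_lambda_measurable_PiM by (simp cong: measurable_cong_sets sets_PiM_cong)
  have "distr (PiM UNIV (\<lambda>i. density lborel (f i))) borel vec_lambda
    = distr (density (PiM UNIV (\<lambda>_. lborel)) (\<lambda>x. \<Prod>i\<in>UNIV. f i (vec_lambda x $ i))) borel vec_lambda"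
    by (subst PiM_density_lborel) (auto simp: sf)
  also have "\<dots> = density lborel (\<lambda>x. \<Prod>i\<in>UNIV. f i (x $ i))"
    by (subst density_distr[symmetric]) (auto simp: distr_vec_lambda_lborel)
  finally show ?thesis .
qed

text \<open>
  Lebesgue measure on matrices is the product of the Lebesgue measures on the rows, so that independence
  of the rows becomes a product formula for the density.
\<close>
lemma (in prob_space) distributed_rows:
  fixes X :: "'a \<Rightarrow> 'e::euclidean_space ^ 'n::finite"
  assumes indep: "indep_vars (\<lambda>_. borel) (\<lambda>i \<omega>. X \<omega> $ i) UNIV"
    and dist: "\<And>i. distributed M lborel (\<lambda>\<omega>. X \<omega> $ i) (f i)"
  shows "distributed M lborel X (\<lambda>x. \<Prod>i\<in>UNIV. f i (x $ i))"
proof -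
  have [measurable]: "f i \<in> borel_measurable borel" for i
    using distributed_borel_measurable[OF dist[of i]] by simp
  have row [measurable]: "(\<lambda>\<omega>. X \<omega> $ i) \<in> borel_measurable M" for i
    using distributed_measurable[OF dist[of i]] by simp
  have X [measurable]: "X \<in> borel_measurable M" by (rule borel_measurable_vecI) simp
  have law: "distr M borel (\<lambda>\<omega>. X \<omega> $ i) = density lborel (f i)" for i
    using distributed_distr_eq_density[OF dist[of i]] by (metis distr_cong sets_lborel)
  have "prob_space (density lborel (f i))" for i
    unfolding law[symmetric] by (rule prob_space_distr) simp
  then have sf: "sigma_finite_measure (density lborel (f i))" for i by (rule prob_space_imp_sigma_finite)
  have "distr M borel X = distr (distr M (PiM UNIV (\<lambda>_. borel)) (\<lambda>\<omega>. \<lambda>i\<in>UNIV. X \<omega> $ i)) borel vec_lambda"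
  proof (subst distr_distr)
    show "(\<lambda>\<omega>. \<lambda>i\<in>UNIV. X \<omega> $ i) \<in> M \<rightarrow>\<^sub>M PiM UNIV (\<lambda>_. borel)" by measurable
  qed (auto simp: o_def restrict_UNIV)
  also have "distr M (PiM UNIV (\<lambda>_. borel)) (\<lambda>\<omega>. \<lambda>i\<in>UNIV. X \<omega> $ i) = PiM UNIV (\<lambda>i. density lborel (f i))"
    using indep by (subst (asm) indep_vars_iff_distr_eq_PiM) (auto simp: law)
  also have "distr \<dots> borel vec_lambda = density lborel (\<lambda>x. \<Prod>i\<in>UNIV. f i (x $ i))"
    by (rule distr_PiM_density_vec_lambda) (auto simp: sf)
  finally have "distr M borel X = density lborel (\<lambda>x. \<Prod>i\<in>UNIV. f i (x $ i))" .
  then show ?thesis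
    unfolding distributed_def by (auto cong: distr_cong)
qed

section \<open>Gram matrices and residual projections\<close>

\<comment> \<open>The rule rewrites products with a transpose into \<open>v*\<close>, which hides the Gram matrix structure.\<close>
declare transpose_matrix_vector [simp del]

lemma matrix_inv_mult:
  assumes "invertible (A :: real ^ 'k ^ 'k::finite)"
  shows "A ** matrix_inv A = mat 1" "matrix_inv A ** A = mat 1"
  using assms unfolding invertible_def matrix_inv_def by (metis (mono_tags, lifting) someI_ex)+

lemma matrix_inv_vec:
  assumes "invertible (A :: real ^ 'k ^ 'k::finite)"
  shows "A *v (matrix_inv A *v x) = x" "matrix_inv A *v (A *v x) = x"
  using matrix_inv_mult[OF assms] by (simp_all add: matrix_vector_mul_assoc)

lemma invertible_if_trivial_kernel:
  fixes A :: "real ^ 'k ^ 'k::finite"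
  assumes "\<And>v. A *v v = 0 \<Longrightarrow> v = 0"
  shows "invertible A"
  using assms by (metis invertible_left_inverse matrix_left_invertible_ker)

lemma pos_def_invertible: "pos_def_matrix A \<Longrightarrow> invertible A"
  by (rule invertible_if_trivial_kernel) (metis inner_zero_right less_irrefl pos_def_matrix_def)

lemma gram_mult_vec: "(transpose X ** X) *v v = transpose X *v (X *v (v :: real ^ 'q))"
  by (simp add: matrix_vector_mul_assoc)

lemma inner_transpose: "x \<bullet> (transpose X *v y) = (X *v x) \<bullet> (y :: real ^ 'n::finite)" for X :: "real ^ 'q::finite ^ 'n"
  by (metis dot_lmul_matrix inner_commute transpose_matrix_vector)

lemma gram_pos_def:
  fixes X :: "real ^ 'q::finite ^ 'n::finite"
  assumes "inj ((*v) X)"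
  shows "pos_def_matrix (transpose X ** X)"
proof -
  have "v \<bullet> ((transpose X ** X) *v v) > 0" if "v \<noteq> 0" for v
  proof -
    have "X *v v \<noteq> 0" using assms that by (metis injD matrix_vector_mult_0_right)
    then show ?thesis by (simp add: gram_mult_vec inner_transpose)
  qed
  then show ?thesis by (simp add: pos_def_matrix_def matrix_transpose_mul)
qed

lemma symmetric_inner:
  fixes A :: "real ^ 'k ^ 'k::finite"
  assumes "transpose A = A"
  shows "x \<bullet> (A *v y) = (A *v x) \<bullet> y"
  by (metis assms inner_transpose)

lemma matrix_inv_symmetric_inner:
  fixes A :: "real ^ 'k ^ 'k::finite"
  assumes "transpose A = A" "invertible A"
  shows "x \<bullet> (matrix_inv A *v y) = (matrix_inv A *v x) \<bullet> y"
  by (metis assms matrix_inv_vec(1) symmetric_inner)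

lemma matrix_inv_pos:
  fixes A :: "real ^ 'k ^ 'k::finite"
  assumes "pos_def_matrix A" "x \<noteq> 0"
  shows "x \<bullet> (matrix_inv A *v x) > 0"
proof -
  have i: "invertible A" using assms by (simp add: pos_def_invertible)
  define y where "y = matrix_inv A *v x"
  have x: "A *v y = x" using matrix_inv_vec[OF i] by (simp add: y_def)
  then have "y \<noteq> 0" using assms by auto
  then have "y \<bullet> (A *v y) > 0" using assms by (simp add: pos_def_matrix_def)
  then show ?thesis by (simp add: x inner_commute y_def[symmetric])
qed

lemma resid_proj_vec:
  "resid_proj X *v y = y - X *v (matrix_inv (transpose X ** X) *v (transpose X *v y))"
  by (simp add: resid_proj_def matrix_vector_mult_diff_rdistrib matrix_vector_mul_assoc matrix_mul_assoc)

context
  fixes X :: "real ^ 'q::finite ^ 'n::finite"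
  assumes inj: "inj ((*v) X)"
begin

lemma invertible_gram: "invertible (transpose X ** X)"
  using gram_pos_def[OF inj] by (rule pos_def_invertible)

lemma transpose_resid: "transpose X *v (resid_proj X *v y) = 0"
  using matrix_inv_vec(1)[OF invertible_gram, of "transpose X *v y"]
  by (simp add: resid_proj_vec matrix_vector_mult_diff_distrib gram_mult_vec)

lemma resid_range: "resid_proj X *v (X *v v) = 0"
  using matrix_inv_vec(2)[OF invertible_gram, of v]
  by (simp add: resid_proj_vec gram_mult_vec)

lemma resid_fix: "transpose X *v y = 0 \<Longrightarrow> resid_proj X *v y = y"
  by (simp add: resid_proj_vec)

lemma resid_inner: "(X *v v) \<bullet> (resid_proj X *v y) = 0"
  by (metis inner_transpose inner_zero_right transpose_resid)

lemma resid_sym: "x \<bullet> (resid_proj X *v y) = (resid_proj X *v x) \<bullet> y"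
proof -
  have "x \<bullet> (resid_proj X *v y) = (resid_proj X *v x) \<bullet> (resid_proj X *v y)" for x y
    using resid_inner[of "matrix_inv (transpose X ** X) *v (transpose X *v x)" y]
    by (simp add: resid_proj_vec[of X x] inner_diff_left)
  then show ?thesis by (metis inner_commute)
qed

lemma resid_quadratic: "y \<bullet> (resid_proj X *v y) = (norm (resid_proj X *v y))\<^sup>2"
  by (metis power2_norm_eq_inner resid_fix resid_sym transpose_resid)

text \<open>
  The regression of the first column on the others can therefore be subtracted from it inside the Schur
  complement.
\<close>
lemma resid_shift: "(y + X *v b) \<bullet> (resid_proj X *v (y + X *v b)) = y \<bullet> (resid_proj X *v y)"
  by (simp add: matrix_vector_right_distrib resid_range inner_add_left resid_inner)

text \<open>
  Orthonormal bases of the column space and of its orthogonal complement together form an orthonormal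
  basis of the whole space, in which the residual projection merely keeps some of the coordinates. The
  number of these is the number of rows minus the number of columns, the degrees of freedom.
\<close>
lemma orthonormal_adapted_to_resid:
  obtains f :: "'n \<Rightarrow> real ^ 'n" and J where
    "card J = CARD('n) - CARD('q)"
    "linear (\<lambda>y. \<chi> j. f j \<bullet> y)" "\<And>y. norm (\<chi> j. f j \<bullet> y) = norm y" "surj (\<lambda>y. \<chi> j. f j \<bullet> y)"
    "\<And>y. y \<bullet> (resid_proj X *v y) = (\<Sum>j\<in>J. (f j \<bullet> y)\<^sup>2)"
proof -
  define W where "W = {y. transpose X *v y = 0}"
  have "subspace W"
    unfolding W_def by (rule linear_subspace_kernel) simp
  then obtain B where B: "B \<subseteq> W" "pairwise orthogonal B" "\<And>x. x \<in> B \<Longrightarrow> norm x = 1" "independent B" "span B = W"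
    by (metis orthonormal_basis_subspace)
  have "subspace (range ((*v) X))" by (intro linear_subspace_image) auto
  then obtain C where C: "C \<subseteq> range ((*v) X)" "pairwise orthogonal C" "\<And>x. x \<in> C \<Longrightarrow> norm x = 1"
     "independent C" "card C = dim (range ((*v) X))" "span C = range ((*v) X)"
    by (metis orthonormal_basis_subspace)
  have cardC: "card C = CARD('q)"
    unfolding C(5) using inj dim_image_eq[of "(*v) X" UNIV] by (simp add: inj_on_def)
  have BC: "b \<bullet> c = 0" if "b \<in> B" "c \<in> C" for b c
    using that B(1) C(1) inner_transpose[of _ X b]
    by (auto simp: W_def inner_commute[of b] dest!: subsetD)
  have disj: "B \<inter> C = {}" using BC B(3) by (metis disjoint_iff inner_eq_zero_iff norm_zero zero_neq_one)
  have fin: "finite B" "finite C" using B(4) C(4) by (auto intro: independent_imp_finite)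
  have orth: "pairwise orthogonal (B \<union> C)"
    using B(2) C(2) BC BC[THEN trans[OF inner_commute]]
    by (auto simp: pairwise_def orthogonal_def)
  have one: "norm x = 1" if "x \<in> B \<union> C" for x using that B(3) C(3) by auto
  have span: "y \<in> span (B \<union> C)" for y
  proof -
    have "resid_proj X *v y \<in> span B" using B(5) transpose_resid by (auto simp: W_def)
    moreover have "X *v (matrix_inv (transpose X ** X) *v (transpose X *v y)) \<in> span C" using C(6) by auto
    ultimately have "resid_proj X *v y + X *v (matrix_inv (transpose X ** X) *v (transpose X *v y)) \<in> span (B \<union> C)"
      by (meson span_add span_mono subsetD sup_ge1 sup_ge2)
    then show ?thesis by (simp add: resid_proj_vec)
  qed
  have "0 \<notin> B \<union> C" using one by force
  then have "independent (B \<union> C)" using orth by (rule pairwise_orthogonal_independent[rotated])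
  then have "card (B \<union> C) = CARD('n)"
    using span by (metis DIM_cart DIM_real UNIV_eq_I dim_UNIV indep_card_eq_dim_span mult.right_neutral)
  then obtain f :: "'n \<Rightarrow> real ^ 'n" where f: "bij_betw f UNIV (B \<union> C)"
    using fin by (metis finite_UnI finite_class.finite_UNIV finite_same_card_bij)
  define J where "J = f -` B"
  have fJ: "bij_betw f J B"
    using f unfolding J_def bij_betw_def by (auto simp: inj_on_def)
  have Parseval: "(\<Sum>b\<in>S. (b \<bullet> y)\<^sup>2) = (norm y)\<^sup>2" if "pairwise orthogonal S" "\<And>x. x \<in> S \<Longrightarrow> norm x = 1" "finite S" "y \<in> span S" for S and y :: "real ^ 'n"
  proof -
    have "(norm y)\<^sup>2 = y \<bullet> (\<Sum>b\<in>S. (y \<bullet> b) *\<^sub>R b)"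
      using orthonormal_basis_expand[OF that(1,2,4,3)] by (simp add: power2_norm_eq_inner)
    then show ?thesis by (simp add: inner_sum_right power2_eq_square inner_commute)
  qed
  have n: "norm (\<chi> j. f j \<bullet> y) = norm y" for y
  proof -
    have "(norm (\<chi> j. f j \<bullet> y))\<^sup>2 = (\<Sum>j\<in>UNIV. (f j \<bullet> y)\<^sup>2)"
      by (simp add: norm_vec_def L2_set_def sum_nonneg)
    also have "\<dots> = (\<Sum>b\<in>B \<union> C. (b \<bullet> y)\<^sup>2)"
      using f by (rule sum.reindex_bij_betw)
    also have "\<dots> = (norm y)\<^sup>2" using orth one fin span by (intro Parseval) auto
    finally show ?thesis by simp
  qed
  have lin: "linear (\<lambda>y. \<chi> j. f j \<bullet> y)"
    by (rule linearI) (auto simp: vec_eq_iff inner_add_right)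
  have "y = 0" if "(\<chi> j. f j \<bullet> y) = 0" for y
    using n[of y] that by simp
  then have "inj (\<lambda>y. \<chi> j. f j \<bullet> y)" unfolding linear_injective_0[OF lin] by blast
  then have s: "surj (\<lambda>y. \<chi> j. f j \<bullet> y)" using lin by (simp add: linear_injective_imp_surjective)
  have q: "y \<bullet> (resid_proj X *v y) = (\<Sum>j\<in>J. (f j \<bullet> y)\<^sup>2)" for y
  proof -
    have "y \<bullet> (resid_proj X *v y) = (\<Sum>b\<in>B. (b \<bullet> (resid_proj X *v y))\<^sup>2)"
      using B fin transpose_resid by (subst Parseval) (auto simp: resid_quadratic W_def)
    also have "\<dots> = (\<Sum>b\<in>B. (b \<bullet> y)\<^sup>2)"
      using B(1) resid_fix by (intro sum.cong) (auto simp: resid_sym W_def dest!: subsetD)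
    also have "\<dots> = (\<Sum>j\<in>J. (f j \<bullet> y)\<^sup>2)"
      using fJ by (rule sum.reindex_bij_betw[symmetric])
    finally show ?thesis .
  qed
  have "card J = card B" using fJ by (rule bij_betw_same_card)
  also have "\<dots> = CARD('n) - CARD('q)"
    using card_Un_disjoint[OF fin disj] \<open>card (B \<union> C) = CARD('n)\<close> cardC by simp
  finally show ?thesis using lin n s q that by blast
qed

end

section \<open>Partitioned matrices and the Schur complement\<close>

lemma sum_option: "(\<Sum>k\<in>(UNIV :: 'q::finite option set). f k) = f None + (\<Sum>j\<in>UNIV. f (Some j))"
  by (simp add: UNIV_option_conv sum.reindex)

lemma gram_blocks:
  fixes X :: "real ^ 'q::finite option ^ 'n::finite"
  shows "blk11 (transpose X ** X) = first_col X \<bullet> first_col X"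
    "blk21 (transpose X ** X) = transpose (rest_cols X) *v first_col X"
    "blk22 (transpose X ** X) = transpose (rest_cols X) ** rest_cols X"
  by (simp_all add: blk11_def blk21_def blk22_def first_col_def rest_cols_def matrix_matrix_mult_def
      transpose_def inner_vec_def matrix_vector_mult_def vec_eq_iff)

text \<open>
  The scalar Schur complement of a Gram matrix is the squared distance of the first column from the span
  of the other columns.
\<close>
lemma schur11_gram:
  fixes X :: "real ^ 'q::finite option ^ 'n::finite"
  shows "schur11 (transpose X ** X) = first_col X \<bullet> (resid_proj (rest_cols X) *v first_col X)"
  using inner_transpose[of "matrix_inv (transpose (rest_cols X) ** rest_cols X) *v (transpose (rest_cols X) *v first_col X)" "rest_cols X" "first_col X"]
  by (simp add: schur11_def gram_blocks resid_proj_vec inner_diff_right inner_commute)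

definition join_vec :: "real \<Rightarrow> real ^ 'q \<Rightarrow> real ^ 'q::finite option" where
  "join_vec a v = (\<chi> k. case k of None \<Rightarrow> a | Some j \<Rightarrow> v $ j)"

definition rest_vec :: "real ^ 'q option \<Rightarrow> real ^ 'q::finite" where
  "rest_vec x = (\<chi> j. x $ Some j)"

lemma join_vec_nth [simp]: "join_vec a v $ None = a" "join_vec a v $ Some j = v $ j" "rest_vec (join_vec a v) = v"
  by (simp_all add: join_vec_def rest_vec_def)

lemma inner_option: "x \<bullet> y = x $ None * y $ None + rest_vec x \<bullet> rest_vec (y :: real ^ 'q::finite option)"
  by (simp add: inner_vec_def sum_option rest_vec_def)

context
  fixes \<Sigma> :: "real ^ ('q::finite option) ^ ('q option)" and b
  assumes pd: "pos_def_matrix \<Sigma>"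
  defines "b \<equiv> matrix_inv (blk22 \<Sigma>) *v blk21 \<Sigma>"
begin

lemma cov_mult_blocks:
  "(\<Sigma> *v x) $ None = blk11 \<Sigma> * x $ None + blk21 \<Sigma> \<bullet> rest_vec x"
  "rest_vec (\<Sigma> *v x) = (x $ None) *\<^sub>R blk21 \<Sigma> + blk22 \<Sigma> *v rest_vec x"
proof -
  have sym: "\<Sigma> $ i $ j = \<Sigma> $ j $ i" for i j using pd by (auto simp: pos_def_matrix_def transpose_def vec_eq_iff)
  show "(\<Sigma> *v x) $ None = blk11 \<Sigma> * x $ None + blk21 \<Sigma> \<bullet> rest_vec x"
    using sym[of None "Some j" for j] by (simp add: matrix_vector_mult_def sum_option blk11_def blk21_def rest_vec_def inner_vec_def)
  show "rest_vec (\<Sigma> *v x) = (x $ None) *\<^sub>R blk21 \<Sigma> + blk22 \<Sigma> *v rest_vec x"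
    by (simp add: matrix_vector_mult_def sum_option blk22_def blk21_def rest_vec_def vec_eq_iff mult.commute)
qed

lemma blk22_pos_def: "pos_def_matrix (blk22 \<Sigma>)"
proof -
  have "transpose (blk22 \<Sigma>) = blk22 \<Sigma>"
    using pd by (simp add: pos_def_matrix_def transpose_def blk22_def vec_eq_iff)
  moreover have "v \<bullet> (blk22 \<Sigma> *v v) > 0" if "v \<noteq> 0" for v
  proof -
    let ?x = "join_vec 0 v"
    have "?x \<noteq> 0" using that by (metis join_vec_nth(2) vec_eq_iff zero_index)
    then have "?x \<bullet> (\<Sigma> *v ?x) > 0" using pd by (simp add: pos_def_matrix_def)
    then show ?thesis by (simp add: inner_option cov_mult_blocks)
  qed
  ultimately show ?thesis by (simp add: pos_def_matrix_def)
qed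

lemma blk22_mult_coeff: "blk22 \<Sigma> *v b = blk21 \<Sigma>"
  using matrix_inv_vec(1)[OF pos_def_invertible[OF blk22_pos_def], of "blk21 \<Sigma>"] by (simp only: b_def)

lemma schur11_coeff: "schur11 \<Sigma> = blk11 \<Sigma> - blk21 \<Sigma> \<bullet> b"
  by (simp only: schur11_def b_def)

lemma schur11_pos: "schur11 \<Sigma> > 0"
proof -
  let ?x = "join_vec 1 (- b)"
  have "?x $ None \<noteq> 0" by simp
  then have "?x \<noteq> 0" by (auto simp del: join_vec_nth)
  then have "?x \<bullet> (\<Sigma> *v ?x) > 0" using pd by (simp add: pos_def_matrix_def)
  moreover have "?x \<bullet> (\<Sigma> *v ?x) = schur11 \<Sigma>"
    using blk22_mult_coeff by (simp add: inner_option cov_mult_blocks schur11_coeff linear_neg)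
  ultimately show ?thesis by simp
qed

text \<open>
  Completing the square in the first coordinate. Solving \<open>\<Sigma> *v w = z\<close> blockwise gives the two summands
  directly, without a formula for the inverse of the partitioned matrix. In terms of the density, the
  first summand is the conditional law of the first coordinate, the second the marginal law of the rest.
\<close>
lemma quadratic_form_split:
  "z \<bullet> (matrix_inv \<Sigma> *v z) = (z $ None - b \<bullet> rest_vec z)\<^sup>2 / schur11 \<Sigma> + rest_vec z \<bullet> (matrix_inv (blk22 \<Sigma>) *v rest_vec z)"
proof -
  have sym: "transpose (blk22 \<Sigma>) = blk22 \<Sigma>" using blk22_pos_def by (simp add: pos_def_matrix_def)
  have inv22: "invertible (blk22 \<Sigma>)" by (rule pos_def_invertible[OF blk22_pos_def])
  define w where "w = matrix_inv \<Sigma> *v z"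
  have z: "z = \<Sigma> *v w" unfolding w_def by (simp add: matrix_inv_vec[OF pos_def_invertible[OF pd]])
  let ?a = "w $ None" and ?v = "rest_vec w"
  have z1: "z $ None = blk11 \<Sigma> * ?a + blk21 \<Sigma> \<bullet> ?v" and z2: "rest_vec z = ?a *\<^sub>R blk21 \<Sigma> + blk22 \<Sigma> *v ?v"
    unfolding z by (rule cov_mult_blocks)+
  have "b \<bullet> (blk22 \<Sigma> *v ?v) = blk21 \<Sigma> \<bullet> ?v" by (simp add: symmetric_inner[OF sym] blk22_mult_coeff)
  then have 1: "z $ None - b \<bullet> rest_vec z = schur11 \<Sigma> * ?a"
    unfolding z1 z2 schur11_coeff by (simp add: inner_add_right inner_commute algebra_simps)
  have "matrix_inv (blk22 \<Sigma>) *v rest_vec z = ?a *\<^sub>R b + ?v"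
    unfolding z2 by (simp add: matrix_vector_right_distrib matrix_vector_mult_scaleR matrix_inv_vec[OF inv22] flip: b_def)
  then have 2: "rest_vec z \<bullet> (matrix_inv (blk22 \<Sigma>) *v rest_vec z) = ?a * (b \<bullet> rest_vec z) + rest_vec z \<bullet> ?v"
    by (simp add: inner_add_right inner_commute)
  have "z \<bullet> w = z $ None * ?a + rest_vec z \<bullet> ?v" by (simp add: inner_option)
  also have "\<dots> = (z $ None - b \<bullet> rest_vec z) * ?a + rest_vec z \<bullet> (matrix_inv (blk22 \<Sigma>) *v rest_vec z)"
    by (simp add: 2 algebra_simps)
  also have "(z $ None - b \<bullet> rest_vec z) * ?a = (z $ None - b \<bullet> rest_vec z)\<^sup>2 / schur11 \<Sigma>"
    using schur11_pos by (simp add: 1 power2_eq_square)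
  finally show ?thesis by (simp add: w_def)
qed

end

section \<open>Gaussian vectors and residual projections\<close>

definition gauss_density :: "real ^ 'n \<Rightarrow> real ^ 'n::finite \<Rightarrow> real" where
  "gauss_density m y = (\<Prod>i\<in>UNIV. normal_density (m $ i) 1 (y $ i))"

definition gauss_law :: "real ^ 'n::finite \<Rightarrow> (real ^ 'n) measure" where
  "gauss_law m = density lborel (\<lambda>y. ennreal (gauss_density m y))"

lemma gauss_density_nonneg [simp]: "0 \<le> gauss_density m y"
  by (simp add: gauss_density_def prod_nonneg)

lemma gauss_density_measurable [measurable]: "gauss_density m \<in> borel_measurable borel"
  unfolding gauss_density_def by measurable

text \<open>
  Up to a constant the density depends only on the distance from the mean, which is why isometries act on
  the Gaussian laws through their means.
\<close>
lemma gauss_density_norm: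
  "gauss_density m (y :: real ^ 'n::finite) = (1 / sqrt (2 * pi)) ^ CARD('n) * exp (- (norm (y - m))\<^sup>2 / 2)"
proof -
  have "gauss_density m y = (1 / sqrt (2 * pi)) ^ CARD('n) * exp (\<Sum>i\<in>UNIV. - (y $ i - m $ i)\<^sup>2 / 2)"
    by (simp add: gauss_density_def normal_density_def prod_dividef power_one_over exp_sum)
  also have "(\<Sum>i\<in>UNIV. - (y $ i - m $ i)\<^sup>2 / 2) = - (norm (y - m))\<^sup>2 / 2"
    by (simp add: norm_vec_def L2_set_def sum_nonneg sum_negf sum_divide_distrib[symmetric])
  finally show ?thesis .
qed

lemma gauss_law_PiM:
  "gauss_law m = distr (PiM UNIV (\<lambda>i. density lborel (\<lambda>z. ennreal (normal_density (m $ i) 1 z)))) borel vec_lambda"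
  by (subst distr_PiM_density_vec_lambda)
    (auto simp: gauss_law_def gauss_density_def prod_ennreal intro!: prob_space_imp_sigma_finite prob_space_normal_density)

lemma sets_gauss_law [simp, measurable_cong]: "sets (gauss_law m) = sets borel"
  by (simp add: gauss_law_def)

lemma vec_lambda_measurable_density:
  "(vec_lambda :: ('n::finite \<Rightarrow> real) \<Rightarrow> _) \<in> PiM UNIV (\<lambda>i. density lborel (f i)) \<rightarrow>\<^sub>M borel"
  using vec_lambda_measurable_PiM by (simp cong: measurable_cong_sets sets_PiM_cong)

lemma prob_space_gauss_law: "prob_space (gauss_law m)"
  unfolding gauss_law_PiM
  by (intro prob_space.prob_space_distr prob_space_PiM vec_lambda_measurable_density prob_space_normal_density) simp

lemma distr_gauss_law_isometry:
  fixes T :: "real ^ 'n::finite \<Rightarrow> real ^ 'n"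
  assumes "linear T" "\<And>x. norm (T x) = norm x" "surj T"
  shows "distr (gauss_law m) borel T = gauss_law (T m)"
proof -
  have [measurable]: "T \<in> borel \<rightarrow>\<^sub>M borel"
    using assms(1) by (intro borel_measurable_continuous_onI linear_continuous_on) (simp add: linear_conv_bounded_linear)
  have "gauss_density m y = gauss_density (T m) (T y)" for y
    using assms(2)[of "y - m"] by (simp add: gauss_density_norm linear_diff[OF assms(1)])
  then have "distr (gauss_law m) borel T = distr (density lborel (\<lambda>y. ennreal (gauss_density (T m) (T y)))) borel T"
    by (simp add: gauss_law_def)
  also have "\<dots> = density (distr lborel borel T) (\<lambda>y. ennreal (gauss_density (T m) y))"
    by (subst density_distr) auto
  finally show ?thesis by (simp add: distr_lborel_isometry[OF assms] gauss_law_def)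
qed

lemma gauss_law_sum_squares:
  fixes m :: "real ^ 'n::finite"
  assumes "J \<noteq> {}"
  shows "distr (gauss_law m) borel (\<lambda>y. \<Sum>j\<in>J. (y $ j)\<^sup>2) = ncchisq_distr (card J) (\<Sum>j\<in>J. (m $ j)\<^sup>2)"
proof -
  let ?N = "\<lambda>i. density lborel (\<lambda>z. ennreal (normal_density (m $ i) 1 z))"
  interpret product_prob_space ?N by (rule product_prob_spaceI) (rule prob_space_normal_density, simp)
  have sum_meas: "(\<lambda>y. \<Sum>j\<in>J. (y j)\<^sup>2) \<in> borel_measurable (PiM J ?N)"
  proof (intro borel_measurable_sum borel_measurable_power)
    fix i assume "i \<in> J"
    then have "(\<lambda>x. x i) \<in> PiM J ?N \<rightarrow>\<^sub>M ?N i" by (rule measurable_component_singleton)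
    also have "PiM J ?N \<rightarrow>\<^sub>M ?N i = borel_measurable (PiM J ?N)" by (rule measurable_cong_sets) simp_all
    finally show "(\<lambda>x. x i) \<in> borel_measurable (PiM J ?N)" .
  qed
  have "distr (gauss_law m) borel (\<lambda>y. \<Sum>j\<in>J. (y $ j)\<^sup>2) = distr (PiM UNIV ?N) borel (\<lambda>y. \<Sum>j\<in>J. (y j)\<^sup>2)"
    unfolding gauss_law_PiM by (subst distr_distr) (auto simp: o_def vec_lambda_measurable_density)
  also have "\<dots> = distr (distr (PiM UNIV ?N) (PiM J ?N) (\<lambda>f. restrict f J)) borel (\<lambda>y. \<Sum>j\<in>J. (y j)\<^sup>2)"
    by (subst distr_distr[OF sum_meas]) (auto simp: o_def intro!: measurable_restrict_subset)
  also have "\<dots> = ncchisq_distr (card J) (\<Sum>j\<in>J. (m $ j)\<^sup>2)"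
    using assms by (subst distr_restrict[symmetric]) (auto intro!: sum_squares_normal_ncchisq)
  finally show ?thesis .
qed

text \<open>
  Rotating to an orthonormal basis adapted to the projection leaves a Gaussian vector with unit covariance
  and turns the quadratic form into a sum of squares of coordinates.
\<close>
lemma gauss_law_resid_quadratic:
  fixes X :: "real ^ 'q::finite ^ 'n::finite"
  assumes inj: "inj ((*v) X)" and "CARD('q) < CARD('n)"
  shows "distr (gauss_law m) borel (\<lambda>y. y \<bullet> (resid_proj X *v y)) = ncchisq_distr (CARD('n) - CARD('q)) (m \<bullet> (resid_proj X *v m))"
proof (rule orthonormal_adapted_to_resid[OF inj])
  fix f :: "'n \<Rightarrow> real ^ 'n" and J
  assume J: "card J = CARD('n) - CARD('q)" and lin: "linear (\<lambda>y. \<chi> j. f j \<bullet> y)"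
    and n: "\<And>y. norm (\<chi> j. f j \<bullet> y) = norm y" and s: "surj (\<lambda>y. \<chi> j. f j \<bullet> y)"
    and q: "\<And>y. y \<bullet> (resid_proj X *v y) = (\<Sum>j\<in>J. (f j \<bullet> y)\<^sup>2)"
  let ?T = "\<lambda>y. \<chi> j. f j \<bullet> y"
  have [measurable]: "?T \<in> borel \<rightarrow>\<^sub>M borel"
    using lin by (intro borel_measurable_continuous_onI linear_continuous_on) (simp add: linear_conv_bounded_linear)
  have "distr (gauss_law m) borel (\<lambda>y. y \<bullet> (resid_proj X *v y)) = distr (distr (gauss_law m) borel ?T) borel (\<lambda>y. \<Sum>j\<in>J. (y $ j)\<^sup>2)"
    by (subst distr_distr) (auto simp: o_def q)
  also have "\<dots> = ncchisq_distr (card J) (\<Sum>j\<in>J. (f j \<bullet> m)\<^sup>2)"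
    using J assms(2) by (subst distr_gauss_law_isometry[OF lin n s], subst gauss_law_sum_squares) auto
  finally show "distr (gauss_law m) borel (\<lambda>y. y \<bullet> (resid_proj X *v y)) = ncchisq_distr (CARD('n) - CARD('q)) (m \<bullet> (resid_proj X *v m))"
    by (simp add: J q)
qed

section \<open>Measurability of matrix operations\<close>

lemma borel_measurable_matrix_mult [measurable (raw)]:
  fixes f :: "'a \<Rightarrow> real ^ 'k::finite ^ 'n::finite" and g :: "'a \<Rightarrow> real ^ 'm::finite ^ 'k"
  assumes [measurable]: "f \<in> borel_measurable M" "g \<in> borel_measurable M"
  shows "(\<lambda>x. f x ** g x) \<in> borel_measurable M"
  by (intro borel_measurable_vecI) (simp add: matrix_matrix_mult_def)

lemma borel_measurable_matrix_vector_mult [measurable (raw)]: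
  fixes f :: "'a \<Rightarrow> real ^ 'k::finite ^ 'n::finite" and g :: "'a \<Rightarrow> real ^ 'k"
  assumes [measurable]: "f \<in> borel_measurable M" "g \<in> borel_measurable M"
  shows "(\<lambda>x. f x *v g x) \<in> borel_measurable M"
  by (intro borel_measurable_vecI) (simp add: matrix_vector_mult_def)

lemma borel_measurable_transpose [measurable (raw)]:
  fixes f :: "'a \<Rightarrow> real ^ 'k::finite ^ 'n::finite"
  assumes [measurable]: "f \<in> borel_measurable M"
  shows "(\<lambda>x. transpose (f x)) \<in> borel_measurable M"
  by (intro borel_measurable_vecI) (simp add: transpose_def)

lemma borel_measurable_det [measurable (raw)]:
  fixes f :: "'a \<Rightarrow> real ^ 'k::finite ^ 'k"
  assumes [measurable]: "f \<in> borel_measurable M"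
  shows "(\<lambda>x. det (f x)) \<in> borel_measurable M"
  unfolding det_def by measurable

text \<open>
  On invertible matrices Cramer's rule expresses the entries as quotients of determinants. All singular
  matrices are sent to one and the same unspecified matrix, because the choice operator is then applied to
  the empty predicate; so the function is measurable everywhere.
\<close>
lemma borel_measurable_matrix_inv [measurable (raw)]:
  fixes f :: "'a \<Rightarrow> real ^ 'k::finite ^ 'k"
  assumes [measurable]: "f \<in> borel_measurable M"
  shows "(\<lambda>x. matrix_inv (f x)) \<in> borel_measurable M"
proof -
  have inv: "matrix_inv A = (if det A \<noteq> 0 then (\<chi> i j. det (\<chi> k l. if l = i then axis j 1 $ k else A $ k $ l) / det A)
     else (SOME B. False))" for A :: "real ^ 'k ^ 'k"
  proof (cases "det A = 0")
    case True
    then have "\<not> (A ** B = mat 1 \<and> B ** A = mat 1)" for B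
      using invertible_det_nz[of A] by (auto simp: invertible_def)
    then have "(\<lambda>B. A ** B = mat 1 \<and> B ** A = mat 1) = (\<lambda>B. False)" by (simp add: fun_eq_iff)
    then show ?thesis using True by (simp only: matrix_inv_def) simp
  next
    case False
    then have i: "invertible A" by (simp add: invertible_det_nz)
    have "matrix_inv A $ i $ j = det (\<chi> k l. if l = i then axis j 1 $ k else A $ k $ l) / det A" for i j
    proof -
      have "matrix_inv A *v axis j 1 = (\<chi> i. det (\<chi> k l. if l = i then axis j 1 $ k else A $ k $ l) / det A)"
        using cramer[OF False, of "matrix_inv A *v axis j 1" "axis j 1"] matrix_inv_vec[OF i] by simp
      then have "(matrix_inv A *v axis j 1) $ i = det (\<chi> k l. if l = i then axis j 1 $ k else A $ k $ l) / det A" by simp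
      then show ?thesis by (simp add: matrix_vector_mult_basis column_def)
    qed
    then show ?thesis using False by (simp add: vec_eq_iff)
  qed
  have [measurable]: "(\<lambda>x. (\<chi> k l. if l = i then axis j 1 $ k else f x $ k $ l) :: real ^ 'k ^ 'k) \<in> borel_measurable M" for i j
    by (intro borel_measurable_vecI) simp
  have [measurable]: "(\<lambda>x. (\<chi> i j. det ((\<chi> k l. if l = i then axis j 1 $ k else f x $ k $ l) :: real ^ 'k ^ 'k) / det (f x)) :: real ^ 'k ^ 'k) \<in> borel_measurable M"
    by (intro borel_measurable_vecI) simp
  show ?thesis unfolding inv by measurable
qed

lemma borel_measurable_resid_proj [measurable (raw)]:
  fixes f :: "'a \<Rightarrow> real ^ 'q::finite ^ 'n::finite"
  assumes [measurable]: "f \<in> borel_measurable M"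
  shows "(\<lambda>x. resid_proj (f x)) \<in> borel_measurable M"
  unfolding resid_proj_def by measurable

lemma borel_measurable_first_col [measurable (raw)]:
  fixes f :: "'a \<Rightarrow> real ^ 'q::finite option ^ 'n::finite"
  assumes [measurable]: "f \<in> borel_measurable M"
  shows "(\<lambda>x. first_col (f x)) \<in> borel_measurable M"
  by (intro borel_measurable_vecI) (simp add: first_col_def)

lemma borel_measurable_rest_cols [measurable (raw)]:
  fixes f :: "'a \<Rightarrow> real ^ 'q::finite option ^ 'n::finite"
  assumes [measurable]: "f \<in> borel_measurable M"
  shows "(\<lambda>x. rest_cols (f x)) \<in> borel_measurable M"
  by (intro borel_measurable_vecI) (simp add: rest_cols_def)

section \<open>Absolute continuity of the residual quadratic form\<close>

text \<open>
  Away from the vertex \<open>- h\<close> the function has two differentiable inverse branches, and differentiable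
  maps take null sets to null sets; hence the preimage of a null set is null.
\<close>
lemma AE_reciprocal_quadratic_notin_null:
  fixes \<gamma> h c :: real
  assumes "\<gamma> > 0" "c > 0" and N: "N \<in> null_sets lborel"
  shows "AE t in lborel. 1 / (\<gamma> * (t + h)\<^sup>2 + c) \<notin> N"
proof -
  define N' where "N' = {y \<in> N. 0 < y \<and> c < 1 / y}"
  define f where "f = (\<lambda>\<sigma> y. - h + \<sigma> * sqrt ((1 / y - c) / \<gamma>) :: real)"
  have neg: "negligible N'"
  proof (rule negligible_subset)
    show "negligible N" using N by (simp add: negligible_iff_null_sets null_sets_completionI)
  qed (auto simp: N'_def)
  have img: "negligible (f \<sigma> ` N')" for \<sigma>
  proof (rule negligible_differentiable_image_negligible[OF _ neg])
    show "f \<sigma> differentiable_on N'"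
    proof (rule differentiable_at_imp_differentiable_on)
      fix y assume "y \<in> N'"
      then have "y > 0" "(1 / y - c) / \<gamma> > 0" using assms by (auto simp: N'_def)
      then show "f \<sigma> differentiable at y"
        unfolding f_def real_differentiable_def
        by (auto intro!: exI derivative_eq_intros)
    qed
  qed simp
  have sub: "{t. 1 / (\<gamma> * (t + h)\<^sup>2 + c) \<in> N} \<subseteq> {- h} \<union> f 1 ` N' \<union> f (- 1) ` N'"
  proof safe
    fix t assume t: "1 / (\<gamma> * (t + h)\<^sup>2 + c) \<in> N" "t \<notin> f (- 1) ` N'" "t \<notin> f 1 ` N'"
    define y where "y = 1 / (\<gamma> * (t + h)\<^sup>2 + c)"
    show "t = - h"
    proof (rule ccontr)
      assume "t \<noteq> - h"
      then have p: "\<gamma> * (t + h)\<^sup>2 > 0" using assms by (simp add: add_eq_0_iff2)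
      have y1: "1 / y = \<gamma> * (t + h)\<^sup>2 + c" by (simp add: y_def)
      have "y > 0" using p assms unfolding y_def by (intro divide_pos_pos) auto
      then have "y \<in> N'" using t(1) p y1 by (simp add: N'_def y_def[symmetric])
      moreover have "sqrt ((1 / y - c) / \<gamma>) = \<bar>t + h\<bar>" using assms by (simp add: y1)
      then have "f 1 y = t \<or> f (- 1) y = t" by (auto simp: f_def abs_if)
      ultimately show False using t by blast
    qed
  qed
  have "negligible {t. 1 / (\<gamma> * (t + h)\<^sup>2 + c) \<in> N}"
    by (rule negligible_subset[OF _ sub]) (intro negligible_Un img negligible_sing)
  moreover have "{t. 1 / (\<gamma> * (t + h)\<^sup>2 + c) \<in> N} \<in> sets borel"
  proof -
    have [measurable]: "N \<in> sets borel" using N by auto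
    show ?thesis by measurable
  qed
  ultimately have "{t. 1 / (\<gamma> * (t + h)\<^sup>2 + c) \<in> N} \<in> null_sets lborel"
    by (simp add: negligible_iff_null_sets null_sets_completion_iff)
  then show ?thesis by (rule AE_I'[where N = "{t. 1 / (\<gamma> * (t + h)\<^sup>2 + c) \<in> N}"]) auto
qed

lemma det_gram_polynomial:
  fixes A R :: "real ^ 'q::finite ^ 'n::finite"
  shows "\<exists>p :: real poly. \<forall>s. poly p s = det (transpose (A + s *\<^sub>R R) ** (A + s *\<^sub>R R))"
proof (intro exI allI)
  define e where "e = (\<lambda>i j. \<Sum>k\<in>UNIV. [:A $ k $ i, R $ k $ i:] * [:A $ k $ j, R $ k $ j:])"
  fix s
  show "poly (\<Sum>\<pi> | \<pi> permutes (UNIV :: 'q set). of_int (sign \<pi>) * (\<Prod>i\<in>UNIV. e i (\<pi> i))) s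
    = det (transpose (A + s *\<^sub>R R) ** (A + s *\<^sub>R R))"
    by (simp add: det_def poly_sum poly_prod e_def matrix_matrix_mult_def transpose_def of_int_poly)
      (simp add: algebra_simps)
qed

text \<open>
  Removes from every column its component along the unit vector \<open>e\<close>.
\<close>
definition drop_dir :: "real ^ 'n \<Rightarrow> real ^ 'q ^ 'n \<Rightarrow> real ^ 'q::finite ^ 'n::finite" where
  "drop_dir e X = (\<chi> i j. X $ i $ j - e $ i * (transpose X *v e) $ j)"

lemma drop_dir_vec: "drop_dir e X *v v = X *v v - (e \<bullet> (X *v v)) *\<^sub>R e"
proof -
  have "e \<bullet> (X *v v) = (transpose X *v e) \<bullet> v"
    by (metis inner_commute inner_transpose)
  moreover have "(\<chi> i j. X $ i $ j - e $ i * a $ j) *v v = X *v v - (a \<bullet> v) *\<^sub>R e" for a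
    by (simp add: vec_eq_iff matrix_vector_mult_def inner_vec_def algebra_simps sum_subtractf sum_distrib_left)
  ultimately show ?thesis by (simp add: drop_dir_def)
qed

lemma drop_dir_add: "drop_dir e (X + Y) = drop_dir e X + drop_dir e Y"
  by (simp add: drop_dir_def vec_eq_iff transpose_def matrix_vector_mult_def sum.distrib algebra_simps)

lemma drop_dir_scale: "drop_dir e (t *\<^sub>R X) = t *\<^sub>R drop_dir e X"
  by (simp add: drop_dir_def vec_eq_iff transpose_def matrix_vector_mult_def sum_distrib_left algebra_simps)

lemma drop_dir_measurable [measurable]: "drop_dir e \<in> borel \<rightarrow>\<^sub>M borel"
  unfolding drop_dir_def by (intro borel_measurable_vecI) simp

lemma inj_iff_det_gram:
  fixes X :: "real ^ 'q::finite ^ 'n::finite"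
  shows "inj ((*v) X) \<longleftrightarrow> det (transpose X ** X) \<noteq> 0"
proof
  assume "inj ((*v) X)"
  then show "det (transpose X ** X) \<noteq> 0" using invertible_gram invertible_det_nz by blast
next
  assume "det (transpose X ** X) \<noteq> 0"
  then have i: "invertible (transpose X ** X)" by (simp add: invertible_det_nz)
  show "inj ((*v) X)"
    unfolding inj_def by (metis gram_mult_vec i matrix_inv_vec(2))
qed

text \<open>
  Linear independence fails only on a null set: along the line \<open>X + t *\<^sub>R D\<close> the Gram determinant is,
  up to a power of \<open>t\<close>, a polynomial in \<open>1 / t\<close>. Its value at \<open>0\<close> is the Gram determinant of \<open>D\<close>, and
  \<open>D\<close> is chosen with independent columns orthogonal to \<open>e\<close>; so all but finitely many \<open>t\<close> are good.
\<close>
lemma AE_inj_drop_dir: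
  fixes e :: "real ^ 'n::finite"
  assumes e: "norm e = 1" and card: "CARD('q::finite) < CARD('n)"
  shows "AE X :: real ^ 'q ^ 'n in lborel. inj ((*v) (drop_dir e X))"
proof -
  have "e \<noteq> 0" using e by auto
  then have "dim {x. e \<bullet> x = 0} = CARD('n) - 1" by (simp add: dim_hyperplane)
  then have "dim (UNIV :: (real ^ 'q) set) \<le> dim {x. e \<bullet> x = 0}" using card by simp
  then have "\<exists>f :: real ^ 'q \<Rightarrow> real ^ 'n. linear f \<and> f \<in> UNIV \<rightarrow> {x. e \<bullet> x = 0} \<and> (\<forall>x. norm (f x) = norm x)"
    by (rule isometry_subset_subspace[OF subspace_UNIV subspace_hyperplane]) blast
  then obtain f :: "real ^ 'q \<Rightarrow> real ^ 'n" where f: "linear f" "f \<in> UNIV \<rightarrow> {x. e \<bullet> x = 0}" "\<And>x. norm (f x) = norm x"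
    by blast
  define D where "D = matrix f"
  have Dv: "D *v v = f v" for v using f(1) by (simp add: D_def matrix_works)
  have drop_dir_D: "drop_dir e D = D"
    using f(2) by (intro matrix_eq[THEN iffD2]) (auto simp: drop_dir_vec Dv)
  have "inj ((*v) D)"
  proof (subst linear_injective_0)
    show "\<forall>x. D *v x = 0 \<longrightarrow> x = 0" using f(3) by (metis Dv norm_eq_zero)
  qed simp
  have "AE t in lborel. inj ((*v) (drop_dir e (X + t *\<^sub>R D)))" for X
  proof -
    obtain p where p: "\<And>s. poly p s = det (transpose (D + s *\<^sub>R drop_dir e X) ** (D + s *\<^sub>R drop_dir e X))"
      using det_gram_polynomial[of D "drop_dir e X"] by blast
    have "poly p 0 \<noteq> 0" using \<open>inj ((*v) D)\<close> unfolding p by (simp flip: inj_iff_det_gram)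
    then have "p \<noteq> 0" by auto
    then have "finite {s. poly p s = 0}" by (rule poly_roots_finite)
    then have fin: "finite (insert 0 (inverse ` {s. poly p s = 0}))" by simp
    \<comment> \<open>\<open>t = 0\<close> is added to the exceptions because the polynomial is in \<open>1 / t\<close>\<close>
    have bad: "t \<in> insert 0 (inverse ` {s. poly p s = 0})" if "\<not> inj ((*v) (drop_dir e (X + t *\<^sub>R D)))" for t
    proof (cases "t = 0")
      case False
      then have "drop_dir e (X + t *\<^sub>R D) = t *\<^sub>R (D + inverse t *\<^sub>R drop_dir e X)"
        by (simp add: drop_dir_add drop_dir_scale drop_dir_D scaleR_add_right)
      then have "drop_dir e (X + t *\<^sub>R D) *v v = t *\<^sub>R ((D + inverse t *\<^sub>R drop_dir e X) *v v)" for v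
        by (simp add: scaleR_matrix_vector_assoc)
      then have "inj ((*v) (drop_dir e (X + t *\<^sub>R D)))" if "inj ((*v) (D + inverse t *\<^sub>R drop_dir e X))"
        using that False by (auto simp: inj_def)
      then have "poly p (inverse t) = 0" using \<open>\<not> inj ((*v) (drop_dir e (X + t *\<^sub>R D)))\<close> unfolding p inj_iff_det_gram by blast
      then show ?thesis by (auto simp: image_iff intro!: exI[of _ "inverse t"])
    qed simp
    show ?thesis
      by (rule AE_I'[OF finite_imp_null_set_lborel[OF fin]]) (use bad in auto)
  qed
  then have lines: "AE X in lborel. AE t in lborel. inj ((*v) (drop_dir e (X + t *\<^sub>R D)))" by simp
  show ?thesis
  proof (rule AE_lborel_along_lines[OF _ lines])
    show "Measurable.pred borel (\<lambda>X. inj ((*v) (drop_dir e X)))"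
      unfolding inj_iff_det_gram by measurable
  qed
qed

lemma inj_drop_dir_imp_inj: "inj ((*v) (drop_dir e X)) \<Longrightarrow> inj ((*v) X)"
proof (rule injI)
  fix x y assume inj: "inj ((*v) (drop_dir e X))" and "X *v x = X *v y"
  then have "drop_dir e X *v x = drop_dir e X *v y" by (simp add: drop_dir_vec)
  then show "x = y" using inj by (simp add: inj_eq)
qed

text \<open>
  A Sherman-Morrison computation. Splitting off the direction \<open>e\<close> gives
  \<open>transpose X ** X = B + a a'\<close> with \<open>a\<close> the components of the columns along \<open>e\<close>. The point is that
  moving \<open>X\<close> along \<open>e\<close> changes only \<open>a\<close> and not \<open>B\<close>.
\<close>
lemma resid_quadratic_reciprocal:
  fixes X :: "real ^ 'q::finite ^ 'n::finite"
  assumes e: "norm e = 1" and inj: "inj ((*v) (drop_dir e X))"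
  defines "a \<equiv> transpose X *v e" and "B \<equiv> transpose (drop_dir e X) ** drop_dir e X"
  shows "e \<bullet> (resid_proj X *v e) = 1 / (1 + a \<bullet> (matrix_inv B *v a))"
proof -
  have injX: "inj ((*v) X)" using inj by (rule inj_drop_dir_imp_inj)
  have ee: "e \<bullet> e = 1" using e by (simp add: norm_eq_1)
  have drop_dir': "transpose (drop_dir e X) *v w = transpose X *v w - (e \<bullet> w) *\<^sub>R a" for w
  proof (rule vector_eq_ldot[THEN iffD1], intro allI)
    fix v
    have "v \<bullet> (transpose (drop_dir e X) *v w) = (X *v v) \<bullet> w - (e \<bullet> (X *v v)) * (e \<bullet> w)"
      by (simp add: inner_transpose drop_dir_vec inner_diff_left)
    also have "e \<bullet> (X *v v) = v \<bullet> a" by (simp add: a_def inner_transpose inner_commute)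
    finally show "v \<bullet> (transpose (drop_dir e X) *v w) = v \<bullet> (transpose X *v w - (e \<bullet> w) *\<^sub>R a)"
      by (simp add: inner_diff_right inner_transpose[of v X w])
  qed
  define y where "y = matrix_inv B *v a"
  have "invertible B" unfolding B_def using inj by (rule invertible_gram)
  then have By: "B *v y = a" unfolding y_def by (rule matrix_inv_vec)
  have Xy: "e \<bullet> (X *v y) = a \<bullet> y"
    using inner_transpose[of y X e] by (simp add: a_def inner_commute)
  have "B *v y = transpose X *v (X *v y) - (a \<bullet> y) *\<^sub>R a"
    unfolding B_def gram_mult_vec drop_dir' by (simp add: drop_dir_vec matrix_vector_mult_diff_distrib matrix_vector_mult_scaleR Xy inner_diff_right ee flip: a_def)
  then have "(transpose X ** X) *v y = (1 + a \<bullet> y) *\<^sub>R a"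
    by (simp add: By gram_mult_vec algebra_simps)
  then have "y = (1 + a \<bullet> y) *\<^sub>R (matrix_inv (transpose X ** X) *v a)"
    by (metis invertible_gram[OF injX] matrix_inv_vec(2) matrix_vector_mult_scaleR)
  then have ay: "a \<bullet> y = (1 + a \<bullet> y) * (a \<bullet> (matrix_inv (transpose X ** X) *v a))"
    by (metis inner_scaleR_right)
  have "a \<bullet> y \<ge> 0"
  proof (cases "a = 0")
    case False
    then show ?thesis unfolding y_def B_def using matrix_inv_pos[OF gram_pos_def[OF inj]] by (simp add: less_imp_le)
  qed simp
  have "e \<bullet> (resid_proj X *v e) = 1 - e \<bullet> (X *v (matrix_inv (transpose X ** X) *v a))"
    by (simp add: resid_proj_vec inner_diff_right ee flip: a_def)
  also have "\<dots> = 1 - a \<bullet> (matrix_inv (transpose X ** X) *v a)"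
    using inner_transpose[of "matrix_inv (transpose X ** X) *v a" X e] by (simp add: a_def inner_commute)
  also have "\<dots> = 1 / (1 + a \<bullet> y)"
    using ay \<open>a \<bullet> y \<ge> 0\<close> by (simp add: field_simps)
  finally show ?thesis by (simp add: y_def)
qed

lemma quadratic_complete_square:
  fixes B :: "real ^ 'k ^ 'k::finite"
  assumes pd: "pos_def_matrix B" and "d \<noteq> 0"
  obtains \<gamma> h c where "\<gamma> > 0" "c > 0" "\<And>t. 1 + (a + t *\<^sub>R d) \<bullet> (matrix_inv B *v (a + t *\<^sub>R d)) = \<gamma> * (t + h)\<^sup>2 + c"
proof -
  let ?q = "\<lambda>x y. x \<bullet> (matrix_inv B *v y)"
  have sym: "?q x y = ?q y x" for x y
    using matrix_inv_symmetric_inner[of B x y] pd pos_def_invertible[OF pd] by (simp add: pos_def_matrix_def inner_commute)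
  have pos: "?q x x \<ge> 0" for x
    using matrix_inv_pos[OF pd, of x] by (cases "x = 0") auto
  define \<gamma> where "\<gamma> = ?q d d"
  have \<gamma>: "\<gamma> > 0" unfolding \<gamma>_def using pd \<open>d \<noteq> 0\<close> by (rule matrix_inv_pos)
  \<comment> \<open>the minimum of the quadratic form along the line is attained at \<open>- h\<close>\<close>
  define h where "h = ?q a d / \<gamma>"
  define c where "c = 1 + ?q (a - h *\<^sub>R d) (a - h *\<^sub>R d)"
  have "c > 0" unfolding c_def using pos[of "a - h *\<^sub>R d"] by simp
  have h: "?q a d = h * \<gamma>" using \<gamma> by (simp add: h_def)
  have eq: "1 + ?q (a + t *\<^sub>R d) (a + t *\<^sub>R d) = \<gamma> * (t + h)\<^sup>2 + c" for t
  proof -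
    have ex: "?q (a + s *\<^sub>R d) (a + s *\<^sub>R d) = ?q a a + 2 * s * (h * \<gamma>) + s\<^sup>2 * \<gamma>" for s
      using sym[of d a] h by (simp add: matrix_vector_right_distrib matrix_vector_mult_scaleR inner_add_left inner_add_right \<gamma>_def power2_eq_square algebra_simps)
    show ?thesis using ex[of t] ex[of "- h"] by (simp add: c_def power2_eq_square algebra_simps)
  qed
  show ?thesis using that[OF \<gamma> \<open>c > 0\<close> eq] .
qed

text \<open>
  Absolute continuity of the quadratic form. On lines in the direction \<open>e d'\<close> it is the reciprocal of a
  strictly convex quadratic polynomial in the line parameter, so each null set is avoided for almost all
  parameters.
\<close>
lemma AE_resid_quadratic_notin_null:
  fixes e :: "real ^ 'n::finite"
  assumes e: "norm e = 1" and card: "CARD('q::finite) < CARD('n)" and N: "N \<in> null_sets lborel"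
  shows "AE X :: real ^ 'q ^ 'n in lborel. e \<bullet> (resid_proj X *v e) \<notin> N"
proof (rule AE_lborel_along_lines)
  have [measurable]: "N \<in> sets borel" using N by auto
  show "Measurable.pred borel (\<lambda>X :: real ^ 'q ^ 'n. e \<bullet> (resid_proj X *v e) \<notin> N)"
    by measurable
  define d :: "real ^ 'q" where "d = 1"
  define D :: "real ^ 'q ^ 'n" where "D = (\<chi> i j. e $ i * d $ j)"
  have d: "d \<noteq> 0" by (simp add: d_def)
  have ee: "e \<bullet> e = 1" using e by (simp add: norm_eq_1)
  have aD: "transpose D *v e = d"
  proof -
    have "(\<Sum>k\<in>UNIV. e $ k * d $ j * e $ k) = (\<Sum>k\<in>UNIV. e $ k * e $ k) * d $ j" for j
      by (simp add: sum_distrib_right sum_distrib_left mult_ac)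
    then show ?thesis using ee by (simp add: D_def vec_eq_iff transpose_def matrix_vector_mult_def inner_vec_def)
  qed
  have drop_dir_D: "drop_dir e D = 0" unfolding drop_dir_def aD by (simp add: D_def vec_eq_iff)
  show "AE X in lborel. AE t in lborel. e \<bullet> (resid_proj (X + t *\<^sub>R D) *v e) \<notin> N"
    using AE_inj_drop_dir[OF e card]
  proof eventually_elim
    fix X :: "real ^ 'q ^ 'n" assume inj: "inj ((*v) (drop_dir e X))"
    define a where "a = transpose X *v e"
    define B where "B = transpose (drop_dir e X) ** drop_dir e X"
    have drop_dir: "drop_dir e (X + t *\<^sub>R D) = drop_dir e X" for t by (simp add: drop_dir_add drop_dir_scale drop_dir_D)
    have "transpose (X + t *\<^sub>R D) *v e = a + t *\<^sub>R d" for t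
    proof -
      have "transpose (X + t *\<^sub>R D) = transpose X + t *\<^sub>R transpose D" by (simp add: transpose_def vec_eq_iff)
      then show ?thesis by (simp add: a_def matrix_vector_mult_add_rdistrib scaleR_matrix_vector_assoc[symmetric] aD)
    qed
    then have eq: "e \<bullet> (resid_proj (X + t *\<^sub>R D) *v e) = 1 / (1 + (a + t *\<^sub>R d) \<bullet> (matrix_inv B *v (a + t *\<^sub>R d)))" for t
      using resid_quadratic_reciprocal[OF e, of "X + t *\<^sub>R D"] inj by (simp add: drop_dir B_def)
    obtain \<gamma> h c where q: "\<gamma> > 0" "c > 0" "\<And>t. 1 + (a + t *\<^sub>R d) \<bullet> (matrix_inv B *v (a + t *\<^sub>R d)) = \<gamma> * (t + h)\<^sup>2 + c"
      by (rule quadratic_complete_square[OF gram_pos_def[OF inj] d, folded B_def]) blast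
    show "AE t in lborel. e \<bullet> (resid_proj (X + t *\<^sub>R D) *v e) \<notin> N"
      unfolding eq q(3) by (rule AE_reciprocal_quadratic_notin_null[OF q(1,2) N])
  qed
qed

section \<open>Separating the first column of the Gaussian matrix from the others\<close>

text \<open>
  The identification of a matrix with its first column and the remaining columns, used as an isometry.
\<close>
definition join_mat :: "(real ^ 'n) \<times> (real ^ 'q ^ 'n) \<Rightarrow> real ^ ('q::finite option) ^ 'n::finite" where
  "join_mat p = (\<chi> i. join_vec (fst p $ i) (snd p $ i))"

lemma first_col_join_mat [simp]: "first_col (join_mat (a, Z)) = a"
  by (simp add: first_col_def join_mat_def vec_eq_iff)

lemma rest_cols_join_mat [simp]: "rest_cols (join_mat (a, Z)) = Z"
  by (simp add: rest_cols_def join_mat_def vec_eq_iff)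

lemma join_mat_surj: "join_mat (first_col x, rest_cols x) = x"
proof -
  have "join_mat (first_col x, rest_cols x) $ i $ k = x $ i $ k" for i k
    by (cases k) (simp_all add: join_mat_def first_col_def rest_cols_def)
  then show ?thesis by (simp add: vec_eq_iff)
qed

lemma linear_join_mat: "linear join_mat"
proof (rule linearI)
  fix x y :: "(real ^ 'n) \<times> (real ^ 'q ^ 'n)" and c :: real
  have "join_mat (x + y) $ i $ k = (join_mat x + join_mat y) $ i $ k" for i k
    by (cases k) (simp_all add: join_mat_def)
  then show "join_mat (x + y) = join_mat x + join_mat y" by (simp add: vec_eq_iff)
  have "join_mat (c *\<^sub>R x) $ i $ k = (c *\<^sub>R join_mat x) $ i $ k" for i k
    by (cases k) (simp_all add: join_mat_def)
  then show "join_mat (c *\<^sub>R x) = c *\<^sub>R join_mat x" by (simp add: vec_eq_iff)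
qed

lemma norm_join_mat: "norm (join_mat p) = norm p"
proof -
  have "(norm (join_mat p))\<^sup>2 = join_mat p \<bullet> join_mat p" by (simp add: power2_norm_eq_inner)
  also have "\<dots> = fst p \<bullet> fst p + snd p \<bullet> snd p"
    by (simp add: inner_vec_def[of "join_mat p"] inner_vec_def[of "fst p"] inner_vec_def[of "snd p"] inner_option sum.distrib)
      (simp add: join_mat_def)
  also have "\<dots> = (norm p)\<^sup>2" by (simp add: power2_norm_eq_inner inner_prod_def)
  finally show ?thesis by simp
qed

lemma join_mat_measurable [measurable]: "join_mat \<in> borel \<Otimes>\<^sub>M borel \<rightarrow>\<^sub>M borel"
  using linear_join_mat unfolding borel_prod
  by (intro borel_measurable_continuous_onI linear_continuous_on) (simp add: linear_conv_bounded_linear)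

lemma nn_integral_join_mat:
  fixes H :: "real ^ ('q::finite option) ^ 'n::finite \<Rightarrow> ennreal"
  assumes [measurable]: "H \<in> borel_measurable borel"
  shows "(\<integral>\<^sup>+x. H x \<partial>lborel) = (\<integral>\<^sup>+Z. \<integral>\<^sup>+a. H (join_mat (a, Z)) \<partial>lborel \<partial>lborel)"
proof -
  have "surj (join_mat :: _ \<Rightarrow> real ^ ('q option) ^ 'n)" by (rule surjI[where f = "\<lambda>x. (first_col x, rest_cols x)"]) (rule join_mat_surj)
  then have law: "distr (lborel \<Otimes>\<^sub>M lborel) borel join_mat = (lborel :: (real ^ ('q option) ^ 'n) measure)"
    unfolding lborel_prod by (intro distr_lborel_isometry linear_join_mat norm_join_mat)
  have "(\<integral>\<^sup>+x. H x \<partial>lborel) = (\<integral>\<^sup>+p. H (join_mat p) \<partial>(lborel \<Otimes>\<^sub>M lborel))"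
    by (subst law[symmetric], subst nn_integral_distr) auto
  also have "\<dots> = (\<integral>\<^sup>+Z. \<integral>\<^sup>+a. H (join_mat (a, Z)) \<partial>lborel \<partial>lborel)"
    by (rule lborel_pair.nn_integral_snd[symmetric]) simp
  finally show ?thesis .
qed

lemma nn_integral_affine_vec:
  fixes f :: "'e::euclidean_space \<Rightarrow> ennreal"
  assumes [measurable]: "f \<in> borel_measurable borel" and "c > 0"
  shows "(\<integral>\<^sup>+x. f x \<partial>lborel) = ennreal (c ^ DIM('e)) * (\<integral>\<^sup>+y. f (t + c *\<^sub>R y) \<partial>lborel)"
  using assms(2)
  by (subst lborel_affine[of c t]) (auto simp: nn_integral_density nn_integral_distr nn_integral_cmult)

text \<open>
  The joint density of the columns other than the first. The normalising constant is left in the form in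
  which it arises from the joint density, which makes the factorisation of the determinant of a
  partitioned matrix unnecessary: the total mass is one in any case.
\<close>
definition rest_density :: "real ^ ('q::finite option) ^ 'n::finite \<Rightarrow> real ^ ('q option) ^ ('q option) \<Rightarrow> real ^ 'q ^ 'n \<Rightarrow> real" where
  "rest_density M \<Sigma> Z = (\<Prod>i\<in>UNIV. sqrt (schur11 \<Sigma>) * sqrt (2 * pi) *
     exp (- ((Z $ i - rest_cols M $ i) \<bullet> (matrix_inv (blk22 \<Sigma>) *v (Z $ i - rest_cols M $ i))) / 2) / sqrt ((2 * pi) ^ CARD('q option) * det \<Sigma>))"

lemma rest_density_measurable [measurable]: "rest_density M \<Sigma> \<in> borel_measurable borel"
  unfolding rest_density_def by measurable

lemma mvn_density_measurable [measurable]: "mvn_density m S \<in> borel_measurable borel"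
  unfolding mvn_density_def by measurable

context
  fixes M :: "real ^ ('q::finite option) ^ 'n::finite" and \<Sigma> :: "real ^ ('q option) ^ ('q option)" and s b \<mu>
  assumes pd: "pos_def_matrix \<Sigma>"
  defines "s \<equiv> sqrt (schur11 \<Sigma>)" and "b \<equiv> matrix_inv (blk22 \<Sigma>) *v blk21 \<Sigma>" and "\<mu> \<equiv> m_tilde M \<Sigma> /\<^sub>R s"
begin

lemma sqrt_schur11_pos: "s > 0" using schur11_pos[OF pd] by (simp add: s_def)

text \<open>
  With the first entry of a row written as its regression on the others plus \<open>s\<close> times a residual, the
  joint density of the row separates into a normal density of the residual and a factor not involving it.
\<close>
lemma mvn_density_split:
  "s * mvn_density (M $ i) \<Sigma> (join_mat (Z *v b + s *\<^sub>R y, Z) $ i) =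
   normal_density (\<mu> $ i) 1 (y $ i) * (s * sqrt (2 * pi) *
     exp (- ((Z $ i - rest_cols M $ i) \<bullet> (matrix_inv (blk22 \<Sigma>) *v (Z $ i - rest_cols M $ i))) / 2) / sqrt ((2 * pi) ^ CARD('q option) * det \<Sigma>))"
proof -
  define z where "z = join_mat (Z *v b + s *\<^sub>R y, Z) $ i - M $ i"
  have rest: "rest_vec z = Z $ i - rest_cols M $ i"
    by (simp add: z_def rest_vec_def join_mat_def rest_cols_def vec_eq_iff)
  have Zb: "(Z *v b) $ i = b \<bullet> Z $ i" by (simp add: matrix_vector_mult_def inner_vec_def mult.commute)
  have Mb: "(rest_cols M *v b) $ i = b \<bullet> rest_cols M $ i" by (simp add: matrix_vector_mult_def inner_vec_def mult.commute)
  have "z $ None - b \<bullet> rest_vec z = s * y $ i - m_tilde M \<Sigma> $ i"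
    unfolding rest by (simp add: z_def join_mat_def Zb Mb m_tilde_def first_col_def inner_diff_right flip: b_def)
  also have "\<dots> = s * (y $ i - \<mu> $ i)"
    using sqrt_schur11_pos by (simp add: \<mu>_def algebra_simps)
  finally have "(z $ None - b \<bullet> rest_vec z)\<^sup>2 / schur11 \<Sigma> = (y $ i - \<mu> $ i)\<^sup>2"
    using schur11_pos[OF pd] by (simp add: power_mult_distrib s_def)
  then have "z \<bullet> (matrix_inv \<Sigma> *v z) = (y $ i - \<mu> $ i)\<^sup>2 + (Z $ i - rest_cols M $ i) \<bullet> (matrix_inv (blk22 \<Sigma>) *v (Z $ i - rest_cols M $ i))"
    using quadratic_form_split[OF pd, of z, folded b_def] by (simp add: rest)
  then have "mvn_density (M $ i) \<Sigma> (join_mat (Z *v b + s *\<^sub>R y, Z) $ i) =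
      exp (- (y $ i - \<mu> $ i)\<^sup>2 / 2 + - ((Z $ i - rest_cols M $ i) \<bullet> (matrix_inv (blk22 \<Sigma>) *v (Z $ i - rest_cols M $ i))) / 2) /
      sqrt ((2 * pi) ^ CARD('q option) * det \<Sigma>)"
    unfolding mvn_density_def z_def[symmetric] by (simp add: diff_divide_distrib)
  then show ?thesis
    unfolding exp_add by (simp add: normal_density_def)
qed

lemma matrix_density_split:
  "s ^ CARD('n) * (\<Prod>i\<in>UNIV. mvn_density (M $ i) \<Sigma> (join_mat (Z *v b + s *\<^sub>R y, Z) $ i)) = gauss_density \<mu> y * rest_density M \<Sigma> Z"
proof -
  have "s ^ CARD('n) * (\<Prod>i\<in>UNIV. mvn_density (M $ i) \<Sigma> (join_mat (Z *v b + s *\<^sub>R y, Z) $ i)) =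
    (\<Prod>i\<in>UNIV. s * mvn_density (M $ i) \<Sigma> (join_mat (Z *v b + s *\<^sub>R y, Z) $ i))"
    by (simp add: prod.distrib)
  then show ?thesis
    unfolding mvn_density_split prod.distrib[of "\<lambda>i. normal_density (\<mu> $ i) 1 (y $ i)"]
    by (simp add: gauss_density_def rest_density_def s_def)
qed

end

text \<open>
  If the determinant were negative then the density formula would be nonpositive everywhere, so that it
  could not have mass one.
\<close>
lemma (in prob_space) det_nonneg_if_mvn_density:
  assumes "distributed M lborel R (\<lambda>x. ennreal (mvn_density m S x))"
  shows "det S \<ge> 0"
proof (rule ccontr)
  assume "\<not> det S \<ge> 0"
  then have "mvn_density m S x \<le> 0" for x
    by (auto simp: mvn_density_def intro!: divide_nonneg_nonpos mult_nonneg_nonpos)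
  then have "ennreal (mvn_density m S x) = 0" for x by (simp add: ennreal_neg)
  then have "density lborel (\<lambda>x. ennreal (mvn_density m S x)) = density lborel (\<lambda>x. 0)" by simp
  then have "emeasure (distr M lborel R) UNIV = 0"
    unfolding distributed_distr_eq_density[OF assms] by (simp add: emeasure_density)
  moreover have "emeasure (distr M lborel R) UNIV = 1"
    using distributed_measurable[OF assms] by (subst emeasure_distr) (auto simp: emeasure_space_1)
  ultimately show False by simp
qed

lemma rest_density_nonneg:
  assumes "pos_def_matrix \<Sigma>" "det \<Sigma> \<ge> 0"
  shows "rest_density M \<Sigma> Z \<ge> 0"
  using schur11_pos[OF assms(1)] assms(2) unfolding rest_density_def
  by (intro prod_nonneg) (auto intro!: divide_nonneg_nonneg mult_nonneg_nonneg)

text \<open>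
  The standardised residual \<open>(x1 - X2 b) / s\<close> is a Gaussian vector with unit covariance and mean
  \<open>m_tilde / s\<close>, independent of the remaining columns: the shear and scaling of the first column are
  undone by the affine invariance of Lebesgue measure for each fixed value of the other columns.
\<close>
lemma (in prob_space) nn_integral_gaussian_matrix:
  fixes X :: "'a \<Rightarrow> real ^ ('q::finite option) ^ 'n::finite" and Mn :: "real ^ ('q option) ^ 'n"
  assumes pd: "pos_def_matrix \<Sigma>" and G: "gaussian_matrix M X Mn \<Sigma>"
    and [measurable]: "F \<in> borel_measurable (borel \<Otimes>\<^sub>M borel)"
  defines "s \<equiv> sqrt (schur11 \<Sigma>)" and "b \<equiv> matrix_inv (blk22 \<Sigma>) *v blk21 \<Sigma>"
  shows "X \<in> borel_measurable M"
    and "(\<integral>\<^sup>+\<omega>. F ((first_col (X \<omega>) - rest_cols (X \<omega>) *v b) /\<^sub>R s, rest_cols (X \<omega>)) \<partial>M) =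
      (\<integral>\<^sup>+Z. ennreal (rest_density Mn \<Sigma> Z) * (\<integral>\<^sup>+y. F (y, Z) \<partial>gauss_law (m_tilde Mn \<Sigma> /\<^sub>R s)) \<partial>lborel)"
proof -
  have s: "s > 0" using schur11_pos[OF pd] by (simp add: s_def)
  have rows: "distributed M lborel (\<lambda>\<omega>. X \<omega> $ i) (\<lambda>x. ennreal (mvn_density (Mn $ i) \<Sigma> x))" for i
    using G by (simp add: gaussian_matrix_def)
  have det: "det \<Sigma> \<ge> 0" by (rule det_nonneg_if_mvn_density[OF rows])
  have mvn: "mvn_density m \<Sigma> x \<ge> 0" for m x using det by (simp add: mvn_density_def)
  define D where "D = (\<lambda>x :: real ^ ('q option) ^ 'n. \<Prod>i\<in>UNIV. mvn_density (Mn $ i) \<Sigma> (x $ i))"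
  have D0: "D x \<ge> 0" for x unfolding D_def by (intro prod_nonneg) (simp add: mvn)
  have [measurable]: "D \<in> borel_measurable borel" unfolding D_def by measurable
  have dist: "distributed M lborel X (\<lambda>x. ennreal (D x))"
    using distributed_rows[OF _ rows] G unfolding gaussian_matrix_def D_def by (simp add: prod_ennreal mvn)
  show X: "X \<in> borel_measurable M" using distributed_measurable[OF dist] by simp
  let ?F = "\<lambda>x. F ((first_col x - rest_cols x *v b) /\<^sub>R s, rest_cols x)"
  let ?\<mu> = "m_tilde Mn \<Sigma> /\<^sub>R s"
  have F [measurable]: "?F \<in> borel_measurable borel" by measurable
  have "(\<integral>\<^sup>+\<omega>. ?F (X \<omega>) \<partial>M) = (\<integral>\<^sup>+x. ennreal (D x) * ?F x \<partial>lborel)"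
    by (rule distributed_nn_integral[OF dist, symmetric]) simp
  also have "\<dots> = (\<integral>\<^sup>+Z. \<integral>\<^sup>+a. ennreal (D (join_mat (a, Z))) * F ((a - Z *v b) /\<^sub>R s, Z) \<partial>lborel \<partial>lborel)"
    by (subst nn_integral_join_mat) simp_all
  also have "\<dots> = (\<integral>\<^sup>+Z. ennreal (s ^ CARD('n)) * (\<integral>\<^sup>+y. ennreal (D (join_mat (Z *v b + s *\<^sub>R y, Z))) * F (y, Z) \<partial>lborel) \<partial>lborel)"
  proof (intro nn_integral_cong)
    fix Z :: "real ^ 'q ^ 'n"
    have "(\<integral>\<^sup>+a. ennreal (D (join_mat (a, Z))) * F ((a - Z *v b) /\<^sub>R s, Z) \<partial>lborel) =
      ennreal (s ^ DIM(real ^ 'n)) * (\<integral>\<^sup>+y. ennreal (D (join_mat (Z *v b + s *\<^sub>R y, Z))) * F ((Z *v b + s *\<^sub>R y - Z *v b) /\<^sub>R s, Z) \<partial>lborel)"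
      by (rule nn_integral_affine_vec[OF _ s]) measurable
    then show "(\<integral>\<^sup>+a. ennreal (D (join_mat (a, Z))) * F ((a - Z *v b) /\<^sub>R s, Z) \<partial>lborel) =
      ennreal (s ^ CARD('n)) * (\<integral>\<^sup>+y. ennreal (D (join_mat (Z *v b + s *\<^sub>R y, Z))) * F (y, Z) \<partial>lborel)"
      using s by simp
  qed
  also have "\<dots> = (\<integral>\<^sup>+Z. \<integral>\<^sup>+y. ennreal (rest_density Mn \<Sigma> Z) * (ennreal (gauss_density ?\<mu> y) * F (y, Z)) \<partial>lborel \<partial>lborel)"
  proof (intro nn_integral_cong)
    fix Z :: "real ^ 'q ^ 'n"
    have "ennreal (s ^ CARD('n)) * ennreal (D (join_mat (Z *v b + s *\<^sub>R y, Z))) = ennreal (rest_density Mn \<Sigma> Z) * ennreal (gauss_density ?\<mu> y)" for y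
    proof -
      have "ennreal (s ^ CARD('n)) * ennreal (D (join_mat (Z *v b + s *\<^sub>R y, Z))) = ennreal (s ^ CARD('n) * D (join_mat (Z *v b + s *\<^sub>R y, Z)))"
        using s D0 by (simp add: ennreal_mult)
      also have "s ^ CARD('n) * D (join_mat (Z *v b + s *\<^sub>R y, Z)) = rest_density Mn \<Sigma> Z * gauss_density ?\<mu> y"
        using matrix_density_split[OF pd, of Mn Z y] by (simp add: D_def s_def b_def mult.commute)
      also have "ennreal \<dots> = ennreal (rest_density Mn \<Sigma> Z) * ennreal (gauss_density ?\<mu> y)"
        by (rule ennreal_mult[OF rest_density_nonneg[OF pd det] gauss_density_nonneg])
      finally show ?thesis .
    qed
    then show "ennreal (s ^ CARD('n)) * (\<integral>\<^sup>+y. ennreal (D (join_mat (Z *v b + s *\<^sub>R y, Z))) * F (y, Z) \<partial>lborel) =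
       (\<integral>\<^sup>+y. ennreal (rest_density Mn \<Sigma> Z) * (ennreal (gauss_density ?\<mu> y) * F (y, Z)) \<partial>lborel)"
      by (subst nn_integral_cmult[symmetric]) (simp_all add: mult.assoc[symmetric])
  qed
  also have "\<dots> = (\<integral>\<^sup>+Z. ennreal (rest_density Mn \<Sigma> Z) * (\<integral>\<^sup>+y. F (y, Z) \<partial>gauss_law ?\<mu>) \<partial>lborel)"
    unfolding gauss_law_def by (intro nn_integral_cong) (simp add: nn_integral_cmult nn_integral_density)
  finally show "(\<integral>\<^sup>+\<omega>. ?F (X \<omega>) \<partial>M) = (\<integral>\<^sup>+Z. ennreal (rest_density Mn \<Sigma> Z) * (\<integral>\<^sup>+y. F (y, Z) \<partial>gauss_law ?\<mu>) \<partial>lborel)" .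
qed

lemma (in prob_space) distributed_rest_cols:
  fixes X :: "'a \<Rightarrow> real ^ ('q::finite option) ^ 'n::finite" and Mn :: "real ^ ('q option) ^ 'n"
  assumes pd: "pos_def_matrix \<Sigma>" and G: "gaussian_matrix M X Mn \<Sigma>"
  shows "distributed M lborel (\<lambda>\<omega>. rest_cols (X \<omega>)) (\<lambda>Z. ennreal (rest_density Mn \<Sigma> Z))"
proof -
  have [measurable]: "X \<in> borel_measurable M"
    using nn_integral_gaussian_matrix(1)[OF pd G, of "\<lambda>_. 0"] by simp
  have "distr M lborel (\<lambda>\<omega>. rest_cols (X \<omega>)) = density lborel (\<lambda>Z. ennreal (rest_density Mn \<Sigma> Z))"
  proof (rule measure_eqI)
    fix A assume "A \<in> sets (distr M lborel (\<lambda>\<omega>. rest_cols (X \<omega>)))"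
    then have [measurable]: "A \<in> sets borel" by simp
    interpret g: prob_space "gauss_law (m_tilde Mn \<Sigma> /\<^sub>R sqrt (schur11 \<Sigma>))" by (rule prob_space_gauss_law)
    have "emeasure (distr M lborel (\<lambda>\<omega>. rest_cols (X \<omega>))) A = (\<integral>\<^sup>+\<omega>. indicator A (rest_cols (X \<omega>)) \<partial>M)"
      by (subst nn_integral_indicator[symmetric], simp, subst nn_integral_distr) auto
    also have "\<dots> = (\<integral>\<^sup>+Z. ennreal (rest_density Mn \<Sigma> Z) * indicator A Z \<partial>lborel)"
      using nn_integral_gaussian_matrix(2)[OF pd G, of "\<lambda>(y, Z). indicator A Z"] by (simp add: g.emeasure_space_1)
    also have "\<dots> = emeasure (density lborel (\<lambda>Z. ennreal (rest_density Mn \<Sigma> Z))) A"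
      by (simp add: emeasure_density)
    finally show "emeasure (distr M lborel (\<lambda>\<omega>. rest_cols (X \<omega>))) A = emeasure (density lborel (\<lambda>Z. ennreal (rest_density Mn \<Sigma> Z))) A" .
  qed simp
  then show ?thesis by (simp add: distributed_def)
qed

section \<open>Poisson mixtures\<close>

lemma pois_sums: "pois \<delta> sums 1"
proof -
  have "(\<lambda>k. (\<delta> / 2) ^ k /\<^sub>R fact k * exp (- (\<delta> / 2))) sums (exp (\<delta> / 2) * exp (- (\<delta> / 2)))"
    by (intro sums_mult2 exp_converges)
  moreover have "(\<delta> / 2) ^ k /\<^sub>R fact k * exp (- (\<delta> / 2)) = pois \<delta> k" for k
    by (simp add: pois_def field_simps)
  moreover have "exp (\<delta> / 2) * exp (- (\<delta> / 2)) = 1" by (rule exp_minus_inverse)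
  ultimately show ?thesis by (simp only:)
qed

context
  fixes h :: "real \<Rightarrow> real"
  assumes h_nonneg: "\<And>t. t \<in> {0..1} \<Longrightarrow> 0 \<le> h t"
    and h_int: "integrable lborel (\<lambda>t. h t * indicator {0..1} t)"
    and h_mass: "(\<integral>t. h t * indicator {0..1} t \<partial>lborel) = 1"
begin

text \<open>
  Integration term by term, dominated by \<open>(lam / 2) ^ k / fact k * c k * h t\<close>. With \<open>c\<close> the chi-square
  densities at a point this is the expansion into central densities; with \<open>c = 1\<close> it says that the weights
  sum to one.
\<close>
lemma poisson_mixture_sums:
  assumes lam: "0 \<le> lam" and c: "\<And>k. 0 \<le> c k" and sc: "summable (\<lambda>k. (lam / 2) ^ k / fact k * c k)"
  shows "(\<lambda>k. mix_weight lam h k * c k) sums (LBINT t:{0..1}. (\<Sum>k. pois (lam * t) k * c k) * h t)" (is ?sums)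
    and "set_integrable lborel {0..1} (\<lambda>t. (\<Sum>k. pois (lam * t) k * c k) * h t)" (is ?int)
proof -
  let ?H = "\<lambda>t. h t * indicator {0..1} t"
  define f where "f = (\<lambda>k t. ((lam / 2) ^ k / fact k * c k) * ((t ^ k * exp (- lam * t / 2)) * ?H t))"
  have hm [measurable]: "?H \<in> borel_measurable borel"
    using borel_measurable_integrable[OF h_int] by simp
  have H0: "0 \<le> ?H t" for t using h_nonneg by (auto split: split_indicator)
  have C0: "0 \<le> (lam / 2) ^ k / fact k * c k" for k using lam c by simp
  have bound: "norm (f k t) \<le> ((lam / 2) ^ k / fact k * c k) * ?H t" for k t
  proof (cases "t \<in> {0..1}")
    case True
    then have "t ^ k * exp (- lam * t / 2) \<le> 1 * 1"
      using lam by (intro mult_mono power_le_one) auto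
    moreover have "0 \<le> t ^ k * exp (- lam * t / 2)" using True by simp
    ultimately have "\<bar>(t ^ k * exp (- lam * t / 2)) * ?H t\<bar> \<le> ?H t"
      using mult_right_mono[OF _ H0, of "t ^ k * exp (- lam * t / 2)" 1 t] H0[of t]
      by (subst abs_of_nonneg[OF mult_nonneg_nonneg]) (simp_all del: indicator_simps)
    then show ?thesis
      unfolding f_def real_norm_def abs_mult[of "(lam / 2) ^ k / fact k * c k"] abs_of_nonneg[OF C0] by (rule mult_left_mono[OF _ C0])
  qed (simp add: f_def)
  have fint: "integrable lborel (f k)" for k
  proof (rule Bochner_Integration.integrable_bound)
    show "integrable lborel (\<lambda>t. ((lam / 2) ^ k / fact k * c k) * ?H t)" using h_int by simp
    show "AE t in lborel. norm (f k t) \<le> norm (((lam / 2) ^ k / fact k * c k) * ?H t)"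
    proof (rule AE_I2)
      fix t show "norm (f k t) \<le> norm (((lam / 2) ^ k / fact k * c k) * ?H t)"
        using bound[of k t] by (rule order_trans) (simp only: real_norm_def abs_ge_self)
    qed
  qed (simp add: f_def)
  have sf: "summable (\<lambda>k. norm (f k t))" for t
    by (rule summable_comparison_test'[OF summable_mult2[OF sc, of "?H t"], of 0]) (use bound[of _ t] in simp)
  have si: "summable (\<lambda>k. \<integral>t. norm (f k t) \<partial>lborel)"
  proof (rule summable_comparison_test'[OF sc, of 0])
    fix k
    have "(\<integral>t. norm (f k t) \<partial>lborel) \<le> (\<integral>t. ((lam / 2) ^ k / fact k * c k) * ?H t \<partial>lborel)"
      using fint h_int bound by (intro integral_mono) auto
    also have "\<dots> = (lam / 2) ^ k / fact k * c k" using h_mass by simp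
    finally show "norm (\<integral>t. norm (f k t) \<partial>lborel) \<le> (lam / 2) ^ k / fact k * c k" by simp
  qed
  have fk: "f k t = pois (lam * t) k * c k * ?H t" for k t
    by (simp add: f_def pois_def power_mult_distrib power_divide mult_ac)
  have sum_f: "(\<Sum>k. f k t) = indicator {0..1} t *\<^sub>R ((\<Sum>k. pois (lam * t) k * c k) * h t)" for t
  proof (cases "t \<in> {0..1} \<and> h t \<noteq> 0")
    case True
    have "summable (\<lambda>k. f k t)" using sf[of t] by (rule summable_norm_cancel)
    then have "summable (\<lambda>k. pois (lam * t) k * c k * h t)" using True by (simp add: fk)
    then have "summable (\<lambda>k. pois (lam * t) k * c k)" using True summable_divide[of _ "h t"] by fastforce
    then show ?thesis using True by (simp add: fk suminf_mult2)
  next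
    case False
    then have "f k t = 0" for k by (auto simp: f_def)
    then show ?thesis using False by auto
  qed
  have int_f: "(\<integral>t. f k t \<partial>lborel) = mix_weight lam h k * c k" for k
  proof -
    have "(LBINT t:{0..1}. t ^ k * exp (- lam * t / 2) * h t) = (\<integral>t. t ^ k * exp (- lam * t / 2) * ?H t \<partial>lborel)"
      unfolding set_lebesgue_integral_def by (intro Bochner_Integration.integral_cong) (auto simp: mult_ac)
    moreover have "(\<integral>t. f k t \<partial>lborel) = (lam / 2) ^ k / fact k * c k * (\<integral>t. t ^ k * exp (- lam * t / 2) * ?H t \<partial>lborel)"
      unfolding f_def by (rule integral_mult_right_zero)
    ultimately show ?thesis by (simp add: mix_weight_def)
  qed
  show ?sums
    using sums_integral[OF fint AE_I2[OF sf] si] unfolding sum_f int_f set_lebesgue_integral_def .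
  show ?int
    using integrable_suminf[OF fint AE_I2[OF sf] si] unfolding sum_f set_integrable_def .
qed

lemma mix_weight_nonneg: "0 \<le> lam \<Longrightarrow> 0 \<le> mix_weight lam h k"
  unfolding mix_weight_def set_lebesgue_integral_def
  by (intro mult_nonneg_nonneg Bochner_Integration.integral_nonneg)
    (auto simp: h_nonneg split: split_indicator)

lemma mix_weight_sums_1:
  assumes "0 \<le> lam"
  shows "mix_weight lam h sums 1"
proof -
  have "summable (\<lambda>k. (lam / 2) ^ k / fact k * 1)"
    using summable_exp_generic[of "lam / 2"] by (simp only: divide_inverse real_scaleR_def mult_1_right mult_1_left mult.commute)
  from poisson_mixture_sums(1)[OF assms _ this] have "mix_weight lam h sums (LBINT t:{0..1}. (\<Sum>k. pois (lam * t) k) * h t)" by simp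
  also have "(LBINT t:{0..1}. (\<Sum>k. pois (lam * t) k) * h t) = 1"
    using h_mass by (simp add: sums_unique[OF pois_sums, symmetric] set_lebesgue_integral_def mult.commute)
  finally show ?thesis .
qed

lemma ncchisq_mixture:
  assumes "0 \<le> lam" "m > 0"
  shows "(\<lambda>k. mix_weight lam h k * chisq_density (m + 2 * k) w) sums (LBINT t:{0..1}. ncchisq_density m (lam * t) w * h t)"
    and "set_integrable lborel {0..1} (\<lambda>t. ncchisq_density m (lam * t) w * h t)"
  using poisson_mixture_sums[OF assms(1), of "\<lambda>k. chisq_density (m + 2 * k) w"] summable_chisq_mixture[OF assms(2), of "lam / 2" w]
  by (simp_all add: ncchisq_density_pois)

end

section \<open>The scaled Schur complement\<close>

context prob_space
begin

context
  fixes X :: "'a \<Rightarrow> real ^ ('q::finite option) ^ 'n::finite" and Mn :: "real ^ ('q option) ^ 'n"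
    and \<Sigma> :: "real ^ ('q option) ^ ('q option)" and \<rho> u :: "'a \<Rightarrow> real" and lam :: real and \<nu> :: nat
    and unit_m :: "real ^ 'n"
  defines "\<rho> \<equiv> \<lambda>\<omega>. schur11 (transpose (X \<omega>) ** X \<omega>) / schur11 \<Sigma>"
    and "u \<equiv> \<lambda>\<omega>. (m_tilde Mn \<Sigma> \<bullet> (resid_proj (rest_cols (X \<omega>)) *v m_tilde Mn \<Sigma>)) / (norm (m_tilde Mn \<Sigma>))\<^sup>2"
    and "lam \<equiv> (norm (m_tilde Mn \<Sigma>))\<^sup>2 / schur11 \<Sigma>"
    and "\<nu> \<equiv> CARD('n) - CARD('q option) + 1"
    and "unit_m \<equiv> m_tilde Mn \<Sigma> /\<^sub>R norm (m_tilde Mn \<Sigma>)"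
  assumes card: "CARD('n) \<ge> CARD('q option)" and pd: "pos_def_matrix \<Sigma>" and G: "gaussian_matrix M X Mn \<Sigma>"
    and m0: "m_tilde Mn \<Sigma> \<noteq> 0"
begin

lemma degrees_of_freedom: "CARD('q) < CARD('n)" "\<nu> = CARD('n) - CARD('q)" "\<nu> > 0"
  using card by (auto simp: card_UNIV_option \<nu>_def)

lemma X_meas [measurable]: "X \<in> borel_measurable M"
  using nn_integral_gaussian_matrix(1)[OF pd G, of "\<lambda>_. 0"] by simp

lemma lam_pos: "lam > 0"
  using m0 schur11_pos[OF pd] by (simp add: lam_def)

lemma \<rho>_meas [measurable]: "\<rho> \<in> borel_measurable M"
  unfolding \<rho>_def schur11_gram by measurable

lemma u_meas [measurable]: "u \<in> borel_measurable M"
  unfolding u_def by measurable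

lemma norm_unit_m: "norm unit_m = 1"
  using m0 by (simp add: unit_m_def)

lemma u_eq: "u \<omega> = unit_m \<bullet> (resid_proj (rest_cols (X \<omega>)) *v unit_m)"
  by (simp add: u_def unit_m_def matrix_vector_mult_scaleR power2_eq_square divide_inverse)

lemma AE_rest_cols:
  assumes "AE Z in lborel. Q Z"
  shows "AE \<omega> in M. Q (rest_cols (X \<omega>))"
proof -
  have "AE Z in distr M lborel (\<lambda>\<omega>. rest_cols (X \<omega>)). Q Z"
    unfolding distributed_distr_eq_density[OF distributed_rest_cols[OF pd G]]
    using assms by (subst AE_density) auto
  then show ?thesis by (rule AE_distrD[rotated]) simp
qed

lemma AE_inj_rest_cols: "AE Z :: real ^ 'q ^ 'n in lborel. inj ((*v) Z)"
  using AE_inj_drop_dir[OF norm_unit_m degrees_of_freedom(1)] by eventually_elim (rule inj_drop_dir_imp_inj)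

lemma AE_u_range: "AE \<omega> in M. u \<omega> \<in> {0..1}"
  using AE_rest_cols[OF AE_inj_rest_cols]
proof eventually_elim
  fix \<omega> assume inj: "inj ((*v) (rest_cols (X \<omega>)))"
  let ?r = "norm (resid_proj (rest_cols (X \<omega>)) *v unit_m)"
  have q: "u \<omega> = ?r\<^sup>2" unfolding u_eq by (rule resid_quadratic[OF inj])
  moreover have "u \<omega> \<le> 1 * ?r"
    unfolding u_eq by (metis norm_cauchy_schwarz norm_unit_m)
  then have "?r\<^sup>2 \<le> ?r" using q by simp
  then have "?r \<le> 1" by (cases "?r = 0") (auto simp: power2_eq_square)
  then have "?r\<^sup>2 \<le> 1" by (simp add: power_le_one)
  ultimately show "u \<omega> \<in> {0..1}" by simp
qed

text \<open>
  The law of the scaled Schur complement when the remaining columns are frozen at \<open>Z\<close>. Its noncentrality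
  depends on \<open>Z\<close> only through the quadratic form that defines \<open>u\<close>, so conditioning on all of \<open>Z\<close> and
  conditioning on \<open>u\<close> give the same result.
\<close>
lemma residual_law_given_rest_cols:
  fixes Z :: "real ^ 'q ^ 'n"
  assumes "inj ((*v) Z)"
  defines "\<mu> \<equiv> m_tilde Mn \<Sigma> /\<^sub>R sqrt (schur11 \<Sigma>)"
  shows "distr (gauss_law \<mu>) borel (\<lambda>y. y \<bullet> (resid_proj Z *v y)) = ncchisq_distr \<nu> (lam * (unit_m \<bullet> (resid_proj Z *v unit_m)))"
proof -
  have "\<mu> \<bullet> (resid_proj Z *v \<mu>) = lam * (unit_m \<bullet> (resid_proj Z *v unit_m))"
    using m0 schur11_pos[OF pd]
    by (simp add: \<mu>_def lam_def unit_m_def matrix_vector_mult_scaleR power2_eq_square field_simps)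
  then show ?thesis
    using gauss_law_resid_quadratic[OF assms(1) degrees_of_freedom(1), of \<mu>] by (simp add: degrees_of_freedom(2))
qed

lemma AE_prob_space_ncchisq: "AE \<omega> in M. prob_space (ncchisq_distr \<nu> (lam * u \<omega>))"
  using AE_rest_cols[OF AE_inj_rest_cols]
proof eventually_elim
  fix \<omega> assume inj: "inj ((*v) (rest_cols (X \<omega>)))"
  show "prob_space (ncchisq_distr \<nu> (lam * u \<omega>))"
    unfolding u_eq residual_law_given_rest_cols[OF inj, symmetric]
    by (intro prob_space.prob_space_distr prob_space_gauss_law) measurable
qed

lemma ncchisq_kernel_measurable [measurable]:
  assumes [measurable]: "A \<in> sets borel"
  shows "(\<lambda>y. emeasure (ncchisq_distr \<nu> (lam * y)) A) \<in> borel_measurable borel"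
proof -
  have "(\<lambda>y. emeasure (ncchisq_distr \<nu> (lam * y)) A) = (\<lambda>y. \<integral>\<^sup>+w. ennreal (ncchisq_density \<nu> (lam * y) w) * indicator A w \<partial>lborel)"
    by (simp add: ncchisq_distr_def emeasure_density fun_eq_iff)
  moreover have "(\<lambda>(y, w). ncchisq_density \<nu> (lam * y) w) \<in> borel_measurable (borel \<Otimes>\<^sub>M borel)"
    unfolding ncchisq_density_def split_beta by measurable
  then have "(\<lambda>y. \<integral>\<^sup>+w. ennreal (ncchisq_density \<nu> (lam * y) w) * indicator A w \<partial>lborel) \<in> borel_measurable borel"
    by measurable
  ultimately show ?thesis by simp
qed

text \<open>
  The disintegration identity that characterises the conditional law: freeze the remaining columns,
  integrate out the standardised first column, and average again.
\<close>
lemma nn_integral_joint: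
  assumes [measurable]: "A \<in> sets borel" "B \<in> sets borel"
  shows "(\<integral>\<^sup>+\<omega>. indicator A (\<rho> \<omega>) * indicator B (u \<omega>) \<partial>M) =
    (\<integral>\<^sup>+\<omega>. emeasure (ncchisq_distr \<nu> (lam * u \<omega>)) A * indicator B (u \<omega>) \<partial>M)"
proof -
  define s where "s = sqrt (schur11 \<Sigma>)"
  define b where "b = matrix_inv (blk22 \<Sigma>) *v blk21 \<Sigma>"
  let ?\<mu> = "m_tilde Mn \<Sigma> /\<^sub>R s"
  let ?U = "\<lambda>Z. unit_m \<bullet> (resid_proj Z *v unit_m)"
  have s: "s > 0" "s\<^sup>2 = schur11 \<Sigma>" using schur11_pos[OF pd] by (simp_all add: s_def)
  let ?F = "\<lambda>(y, Z). indicator A (y \<bullet> (resid_proj Z *v y)) * indicator B (?U Z) :: ennreal"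
  have "(\<integral>\<^sup>+\<omega>. indicator A (\<rho> \<omega>) * indicator B (u \<omega>) \<partial>M) =
    (\<integral>\<^sup>+\<omega>. ?F ((first_col (X \<omega>) - rest_cols (X \<omega>) *v b) /\<^sub>R s, rest_cols (X \<omega>)) \<partial>M)"
  proof (rule nn_integral_cong_AE)
    show "AE \<omega> in M. indicator A (\<rho> \<omega>) * indicator B (u \<omega>) = ?F ((first_col (X \<omega>) - rest_cols (X \<omega>) *v b) /\<^sub>R s, rest_cols (X \<omega>))"
      using AE_rest_cols[OF AE_inj_rest_cols]
    proof eventually_elim
      fix \<omega> assume inj: "inj ((*v) (rest_cols (X \<omega>)))"
      define y where "y = (first_col (X \<omega>) - rest_cols (X \<omega>) *v b) /\<^sub>R s"
      have "first_col (X \<omega>) = s *\<^sub>R y + rest_cols (X \<omega>) *v b" using s by (simp add: y_def)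
      then have "schur11 (transpose (X \<omega>) ** X \<omega>) = (s *\<^sub>R y) \<bullet> (resid_proj (rest_cols (X \<omega>)) *v (s *\<^sub>R y))"
        unfolding schur11_gram by (simp only: resid_shift[OF inj])
      also have "\<dots> = s\<^sup>2 * (y \<bullet> (resid_proj (rest_cols (X \<omega>)) *v y))"
        by (simp add: matrix_vector_mult_scaleR power2_eq_square)
      finally have "\<rho> \<omega> = y \<bullet> (resid_proj (rest_cols (X \<omega>)) *v y)"
        using s schur11_pos[OF pd] by (simp add: \<rho>_def)
      then show "indicator A (\<rho> \<omega>) * indicator B (u \<omega>) = ?F ((first_col (X \<omega>) - rest_cols (X \<omega>) *v b) /\<^sub>R s, rest_cols (X \<omega>))"
        by (simp add: y_def u_eq)
    qed
  qed
  also have "\<dots> = (\<integral>\<^sup>+Z. ennreal (rest_density Mn \<Sigma> Z) * (\<integral>\<^sup>+y. ?F (y, Z) \<partial>gauss_law ?\<mu>) \<partial>lborel)"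
    unfolding b_def s_def by (rule nn_integral_gaussian_matrix(2)[OF pd G]) measurable
  also have "\<dots> = (\<integral>\<^sup>+Z. ennreal (rest_density Mn \<Sigma> Z) * (emeasure (ncchisq_distr \<nu> (lam * ?U Z)) A * indicator B (?U Z)) \<partial>lborel)"
  proof (rule nn_integral_cong_AE)
    show "AE Z in lborel. ennreal (rest_density Mn \<Sigma> Z) * (\<integral>\<^sup>+y. ?F (y, Z) \<partial>gauss_law ?\<mu>) =
       ennreal (rest_density Mn \<Sigma> Z) * (emeasure (ncchisq_distr \<nu> (lam * ?U Z)) A * indicator B (?U Z))"
      using AE_inj_rest_cols
    proof eventually_elim
      fix Z :: "real ^ 'q ^ 'n" assume inj: "inj ((*v) Z)"
      have "(\<integral>\<^sup>+y. ?F (y, Z) \<partial>gauss_law ?\<mu>) = (\<integral>\<^sup>+y. indicator A (y \<bullet> (resid_proj Z *v y)) \<partial>gauss_law ?\<mu>) * indicator B (?U Z)"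
        by (simp add: nn_integral_multc)
      also have "(\<integral>\<^sup>+y. indicator A (y \<bullet> (resid_proj Z *v y)) \<partial>gauss_law ?\<mu>) =
          (\<integral>\<^sup>+r. indicator A r \<partial>distr (gauss_law ?\<mu>) borel (\<lambda>y. y \<bullet> (resid_proj Z *v y)))"
        by (subst nn_integral_distr) auto
      also have "\<dots> = emeasure (ncchisq_distr \<nu> (lam * ?U Z)) A"
        unfolding s_def residual_law_given_rest_cols[OF inj] by (rule nn_integral_indicator) (simp add: ncchisq_distr_def)
      finally show "ennreal (rest_density Mn \<Sigma> Z) * (\<integral>\<^sup>+y. ?F (y, Z) \<partial>gauss_law ?\<mu>) =
       ennreal (rest_density Mn \<Sigma> Z) * (emeasure (ncchisq_distr \<nu> (lam * ?U Z)) A * indicator B (?U Z))" by simp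
    qed
  qed
  also have "\<dots> = (\<integral>\<^sup>+\<omega>. emeasure (ncchisq_distr \<nu> (lam * u \<omega>)) A * indicator B (u \<omega>) \<partial>M)"
    unfolding u_eq by (rule distributed_nn_integral[OF distributed_rest_cols[OF pd G]]) measurable
  finally show ?thesis .
qed

lemma cond_distributed_\<rho>: "cond_distributed M \<rho> u (\<lambda>t. ncchisq_distr \<nu> (lam * t))"
  unfolding cond_distributed_def
proof (intro conjI ballI \<rho>_meas u_meas)
  fix A :: "real set" assume [measurable]: "A \<in> sets borel"
  show K [measurable]: "(\<lambda>y. measure (ncchisq_distr \<nu> (lam * y)) A) \<in> borel_measurable borel"
    unfolding measure_def by measurable
  let ?F = "vimage_algebra (space M) u borel"
  let ?g = "\<lambda>\<omega>. measure (ncchisq_distr \<nu> (lam * u \<omega>)) A"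
  interpret finite_measure_subalgebra M ?F
  proof
    show "subalgebra M ?F"
      unfolding subalgebra_def using sets_image_in_sets[OF refl u_meas] by (auto simp: sets_vimage_algebra2)
  qed
  show "AE \<omega> in M. real_cond_exp M ?F (\<lambda>\<omega>. indicator A (\<rho> \<omega>)) \<omega> = ?g \<omega>"
  proof (rule real_cond_exp_charact)
    show "?g \<in> borel_measurable ?F"
      by (rule measurable_compose[OF measurable_vimage_algebra1 K]) simp
    show int1: "integrable M (\<lambda>\<omega>. indicator A (\<rho> \<omega>) :: real)"
      by (rule integrable_const_bound[where B = 1]) (auto split: split_indicator)
    have le: "AE \<omega> in M. norm (?g \<omega>) \<le> 1"
      using AE_prob_space_ncchisq by eventually_elim (simp add: prob_space.prob_le_1)
    show int2: "integrable M ?g"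
      by (rule integrable_const_bound[OF le]) measurable
    fix S assume "S \<in> sets ?F"
    then obtain B where B [measurable]: "B \<in> sets borel" and S: "S = u -` B \<inter> space M"
      by (auto simp: sets_vimage_algebra2)
    have "(\<integral>\<omega>\<in>S. indicat_real A (\<rho> \<omega>) \<partial>M) = (\<integral>\<omega>. indicat_real A (\<rho> \<omega>) * indicat_real B (u \<omega>) \<partial>M)"
      unfolding set_lebesgue_integral_def
      by (intro Bochner_Integration.integral_cong) (auto simp: S split: split_indicator)
    also have "\<dots> = enn2real (\<integral>\<^sup>+\<omega>. indicator A (\<rho> \<omega>) * indicator B (u \<omega>) \<partial>M)"
      by (subst integral_eq_nn_integral)
        (auto simp: ennreal_mult ennreal_indicator)
    also have "\<dots> = enn2real (\<integral>\<^sup>+\<omega>. emeasure (ncchisq_distr \<nu> (lam * u \<omega>)) A * indicator B (u \<omega>) \<partial>M)"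
      by (subst nn_integral_joint) simp_all
    also have "(\<integral>\<^sup>+\<omega>. emeasure (ncchisq_distr \<nu> (lam * u \<omega>)) A * indicator B (u \<omega>) \<partial>M) =
       (\<integral>\<^sup>+\<omega>. ennreal (?g \<omega> * indicator B (u \<omega>)) \<partial>M)"
    proof (rule nn_integral_cong_AE)
      show "AE \<omega> in M. emeasure (ncchisq_distr \<nu> (lam * u \<omega>)) A * indicator B (u \<omega>) = ennreal (?g \<omega> * indicator B (u \<omega>))"
        using AE_prob_space_ncchisq
      proof eventually_elim
        fix \<omega> assume "prob_space (ncchisq_distr \<nu> (lam * u \<omega>))"
        then interpret K: prob_space "ncchisq_distr \<nu> (lam * u \<omega>)" .
        show "emeasure (ncchisq_distr \<nu> (lam * u \<omega>)) A * indicator B (u \<omega>) = ennreal (?g \<omega> * indicator B (u \<omega>))"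
          by (simp add: K.emeasure_eq_measure ennreal_mult ennreal_indicator)
      qed
    qed
    also have "enn2real \<dots> = (\<integral>\<omega>. ?g \<omega> * indicator B (u \<omega>) \<partial>M)"
      by (subst integral_eq_nn_integral) auto
    also have "\<dots> = (\<integral>\<omega>\<in>S. ?g \<omega> \<partial>M)"
      unfolding set_lebesgue_integral_def
      by (intro Bochner_Integration.integral_cong) (auto simp: S split: split_indicator)
    finally show "(\<integral>\<omega>\<in>S. indicat_real A (\<rho> \<omega>) \<partial>M) = (\<integral>\<omega>\<in>S. ?g \<omega> \<partial>M)" .
  qed
qed

text \<open>
  Radon-Nikodym gives the density once the law is known to be absolutely continuous. The derivative may be
  infinite or live outside the unit interval on a null set, which passing to real values and restricting
  to \<open>{0..1}\<close> repairs.
\<close>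
lemma u_pdf_exists: "\<exists>h. is_pdf_on M u {0..1} h"
proof -
  let ?D = "distr M borel u"
  have "null_sets lborel \<subseteq> null_sets ?D"
  proof
    fix N :: "real set" assume N: "N \<in> null_sets lborel"
    then have [measurable]: "N \<in> sets borel" by auto
    have "AE \<omega> in M. u \<omega> \<notin> N"
      unfolding u_eq by (rule AE_rest_cols[OF AE_resid_quadratic_notin_null[OF norm_unit_m degrees_of_freedom(1) N]])
    then have "AE x in ?D. x \<notin> N" by (subst AE_distr_iff) auto
    then show "N \<in> null_sets ?D" by (subst (asm) AE_iff_null_sets[symmetric]) auto
  qed
  then have "absolutely_continuous lborel ?D" by (simp add: absolutely_continuous_def)
  then obtain f where f [measurable]: "f \<in> borel_measurable lborel" and df: "density lborel f = ?D"
    using sigma_finite_measure.Radon_Nikodym[OF sigma_finite_lborel, of ?D] by auto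
  interpret D: prob_space ?D by (rule prob_space_distr) simp
  have "(\<integral>\<^sup>+x. f x \<partial>lborel) = emeasure (density lborel f) UNIV" by (simp add: emeasure_density)
  also have "\<dots> = 1" unfolding df using D.emeasure_space_1 by simp
  finally have "AE x in lborel. f x \<noteq> \<infinity>" by (intro nn_integral_PInf_AE) auto
  moreover have "AE x in lborel. x \<notin> {0..1} \<longrightarrow> f x = 0"
  proof -
    have "AE x in ?D. x \<in> {0..1}" using AE_u_range by (subst AE_distr_iff) auto
    then have "AE x in lborel. 0 < f x \<longrightarrow> x \<in> {0..1}"
      unfolding df[symmetric] by (subst (asm) AE_density) auto
    then show ?thesis by eventually_elim (auto simp: zero_less_iff_neq_zero)
  qed
  ultimately have "AE x in lborel. f x = ennreal (enn2real (f x) * indicator {0..1} x)"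
    by eventually_elim (auto simp: less_top split: split_indicator)
  then have "density lborel f = density lborel (\<lambda>x. ennreal (enn2real (f x) * indicator {0..1} x))"
    by (intro density_cong) auto
  then have "is_pdf_on M u {0..1} (\<lambda>x. enn2real (f x))"
    unfolding is_pdf_on_def distributed_def df by (auto cong: distr_cong)
  then show ?thesis by blast
qed

text \<open>
  The conditional density is integrated against the density of \<open>u\<close>, exchanging the order of integration.
  The values of \<open>h\<close> outside \<open>{0..1}\<close> are arbitrary, whence the indicator function that accompanies it.
\<close>
lemma pdf_mixture:
  assumes h: "is_pdf_on M u {0..1} h"
  shows "is_pdf_on M \<rho> {0<..} (\<lambda>w. LBINT t:{0..1}. ncchisq_density \<nu> (lam * t) w * h t) \<and>
       (\<forall>w>0. (\<lambda>k. mix_weight lam h k * chisq_density (\<nu> + 2 * k) w) sums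
                (LBINT t:{0..1}. ncchisq_density \<nu> (lam * t) w * h t)) \<and>
       (\<forall>k. mix_weight lam h k \<ge> 0) \<and>
       (mix_weight lam h) sums 1"
proof -
  let ?H = "\<lambda>t. h t * indicator {0..1} t"
  have h0: "0 \<le> h t" if "t \<in> {0..1}" for t using h that by (simp add: is_pdf_on_def)
  then have H0: "0 \<le> ?H t" for t by (auto split: split_indicator)
  have dist: "distributed M lborel u (\<lambda>t. ennreal (?H t))" using h by (simp add: is_pdf_on_def)
  have Hm [measurable]: "?H \<in> borel_measurable borel"
    using distributed_real_measurable[OF _ dist] H0 by simp
  have "(\<integral>\<^sup>+t. ennreal (?H t) \<partial>lborel) = (\<integral>\<^sup>+\<omega>. 1 \<partial>M)"
    using distributed_nn_integral[OF dist, of "\<lambda>_. 1"] by simp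
  then have H1: "(\<integral>\<^sup>+t. ennreal (?H t) \<partial>lborel) = ennreal 1" by (simp add: emeasure_space_1)
  then have Hint: "integrable lborel ?H" and Hmass: "(\<integral>t. ?H t \<partial>lborel) = 1"
    using nn_integral_eq_integrable[of ?H lborel 1] H0 by auto
  note l0 = lam_pos[THEN less_imp_le] and mixture = ncchisq_mixture[OF h0 Hint Hmass lam_pos[THEN less_imp_le] degrees_of_freedom(3)]
  define p where "p = (\<lambda>w. LBINT t:{0..1}. ncchisq_density \<nu> (lam * t) w * h t)"
  have p_eq: "p w = (\<integral>t. ncchisq_density \<nu> (lam * t) w * ?H t \<partial>lborel)" for w
    unfolding p_def set_lebesgue_integral_def by (intro Bochner_Integration.integral_cong) (auto simp: mult_ac)
  have nc2 [measurable]: "(\<lambda>(w, t). ncchisq_density \<nu> (lam * t) w) \<in> borel_measurable (borel \<Otimes>\<^sub>M borel)"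
    unfolding ncchisq_density_def split_beta by measurable
  have [measurable]: "p \<in> borel_measurable borel"
    unfolding p_eq[abs_def] by measurable
  have nc0: "0 \<le> ncchisq_density \<nu> (lam * t) w * ?H t" for t w
    using ncchisq_nonneg[of "lam * t" \<nu> w] l0 degrees_of_freedom(3) h0[of t] by (auto split: split_indicator)
  have p0: "0 \<le> p w" for w unfolding p_eq using nc0 by (intro Bochner_Integration.integral_nonneg) simp
  have p_nn: "(\<integral>\<^sup>+t. ennreal (ncchisq_density \<nu> (lam * t) w * ?H t) \<partial>lborel) = ennreal (p w)" for w
  proof -
    have "integrable lborel (\<lambda>t. ncchisq_density \<nu> (lam * t) w * ?H t)"
      using mixture(2)[of w] unfolding set_integrable_def by (simp add: mult_ac)
    then show ?thesis unfolding p_eq using nc0 by (intro nn_integral_eq_integral) auto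
  qed
  have "distr M lborel \<rho> = density lborel (\<lambda>w. ennreal (p w * indicator {0<..} w))"
  proof (rule measure_eqI)
    fix A assume "A \<in> sets (distr M lborel \<rho>)"
    then have [measurable]: "A \<in> sets borel" by simp
    have "emeasure (distr M lborel \<rho>) A = (\<integral>\<^sup>+\<omega>. indicator A (\<rho> \<omega>) \<partial>M)"
      by (subst nn_integral_indicator[symmetric], simp, subst nn_integral_distr) auto
    also have "\<dots> = (\<integral>\<^sup>+\<omega>. emeasure (ncchisq_distr \<nu> (lam * u \<omega>)) A \<partial>M)"
      using nn_integral_joint[of A UNIV] by simp
    also have "\<dots> = (\<integral>\<^sup>+t. ennreal (?H t) * emeasure (ncchisq_distr \<nu> (lam * t)) A \<partial>lborel)"
      by (rule distributed_nn_integral[OF dist, symmetric]) simp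
    also have "\<dots> = (\<integral>\<^sup>+t. \<integral>\<^sup>+w. ennreal (ncchisq_density \<nu> (lam * t) w * ?H t) * indicator A w \<partial>lborel \<partial>lborel)"
    proof (intro nn_integral_cong)
      fix t
      have "ennreal (ncchisq_density \<nu> (lam * t) w * ?H t) = ennreal (?H t) * ennreal (ncchisq_density \<nu> (lam * t) w)" for w
        using H0[of t] by (simp add: ennreal_mult'' mult.commute)
      then show "ennreal (?H t) * emeasure (ncchisq_distr \<nu> (lam * t)) A =
        (\<integral>\<^sup>+w. ennreal (ncchisq_density \<nu> (lam * t) w * ?H t) * indicator A w \<partial>lborel)"
        by (simp add: ncchisq_distr_def emeasure_density nn_integral_cmult mult.assoc)
    qed
    also have "\<dots> = (\<integral>\<^sup>+w. \<integral>\<^sup>+t. ennreal (ncchisq_density \<nu> (lam * t) w * ?H t) * indicator A w \<partial>lborel \<partial>lborel)"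
      by (rule lborel_pair.Fubini') measurable
    also have "\<dots> = (\<integral>\<^sup>+w. ennreal (p w) * indicator A w \<partial>lborel)"
      by (simp add: nn_integral_multc p_nn)
    also have "\<dots> = (\<integral>\<^sup>+w. ennreal (p w * indicator {0<..} w) * indicator A w \<partial>lborel)"
      by (intro nn_integral_cong) (auto simp: p_eq ncchisq_density_nonpos split: split_indicator)
    also have "\<dots> = emeasure (density lborel (\<lambda>w. ennreal (p w * indicator {0<..} w))) A"
      by (simp add: emeasure_density)
    finally show "emeasure (distr M lborel \<rho>) A = emeasure (density lborel (\<lambda>w. ennreal (p w * indicator {0<..} w))) A" .
  qed simp
  then have "is_pdf_on M \<rho> {0<..} p"
    unfolding is_pdf_on_def distributed_def using p0 by simp
  then show ?thesis
    using mixture(1) mix_weight_nonneg[OF h0 Hint Hmass l0] mix_weight_sums_1[OF h0 Hint Hmass l0]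
    unfolding p_def by blast
qed

end

end

theorem mainTheorem1:
  fixes P :: "'a measure"
    and X :: "'a \<Rightarrow> real ^ ('q::finite option) ^ 'n::finite"
    and M :: "real ^ ('q option) ^ 'n"
    and \<Sigma> :: "real ^ ('q option) ^ ('q option)"
    and \<rho> u :: "'a \<Rightarrow> real"
    and lam :: real
    and \<nu> :: nat
  defines "\<rho> \<equiv> \<lambda>\<omega>. schur11 (transpose (X \<omega>) ** X \<omega>) / schur11 \<Sigma>"
    and "u \<equiv> \<lambda>\<omega>. (m_tilde M \<Sigma> \<bullet> (resid_proj (rest_cols (X \<omega>)) *v m_tilde M \<Sigma>)) / (norm (m_tilde M \<Sigma>))\<^sup>2"
    and "lam \<equiv> (norm (m_tilde M \<Sigma>))\<^sup>2 / schur11 \<Sigma>"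
    and "\<nu> \<equiv> CARD('n) - CARD('q option) + 1"
  assumes "prob_space P"
    and "CARD('q option) \<ge> 2" and "CARD('n) \<ge> CARD('q option)"
    and "pos_def_matrix \<Sigma>"
    and "gaussian_matrix P X M \<Sigma>"
    and "m_tilde M \<Sigma> \<noteq> 0"
  shows "cond_distributed P \<rho> u (\<lambda>t. ncchisq_distr \<nu> (lam * t)) \<and>
    (\<exists>h. is_pdf_on P u {0..1} h) \<and>
    (\<forall>h. is_pdf_on P u {0..1} h \<longrightarrow>
       is_pdf_on P \<rho> {0<..} (\<lambda>w. LBINT t:{0..1}. ncchisq_density \<nu> (lam * t) w * h t) \<and>
       (\<forall>w>0. (\<lambda>k. mix_weight lam h k * chisq_density (\<nu> + 2 * k) w) sums
                (LBINT t:{0..1}. ncchisq_density \<nu> (lam * t) w * h t)) \<and>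
       (\<forall>k. mix_weight lam h k \<ge> 0) \<and>
       (mix_weight lam h) sums 1)"
proof -
  interpret prob_space P by (rule \<open>prob_space P\<close>)
  note setting = \<open>CARD('n) \<ge> CARD('q option)\<close> \<open>pos_def_matrix \<Sigma>\<close> \<open>gaussian_matrix P X M \<Sigma>\<close> \<open>m_tilde M \<Sigma> \<noteq> 0\<close>
  show ?thesis
    unfolding \<rho>_def u_def lam_def \<nu>_def
    by (rule conjI[OF cond_distributed_\<rho>[OF setting] conjI[OF u_pdf_exists[OF setting]]],
        intro allI impI, rule pdf_mixture[OF setting])
qed

end
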